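(* Let $\mathfrak{g}_h$ and $\tilde{\mathfrak{g}}_h$ be the left–right dual $n$-dimensional Lie algebras over $\mathbb{K}$ ($\mathbb{K}=\mathbb{R}$ or $\mathbb{C}$) with bases $X_1,\dots,X_n$ and $Y_1,\dots,Y_n$, respectively, and brackets $$[X_\mu,X_\nu]=\sum_{\alpha=1}^n C_{\mu\nu\alpha}X_\alpha,\qquad [Y_\mu,Y_\nu]=-\sum_{\alpha=1}^n C_{\mu\nu\alpha}Y_\alpha,$$ where $C_{\mu\nu\alpha}=C_{\mu\nu\alpha}(h)$ depends on a parameter $h\in\mathbb{R}$ with $\lim_{h\to0}C_{\mu\nu\alpha}(h)=0$. Let $\mathbf{C}$ be the $n\times n$ matrix with entries $\mathbf{C}_{\mu\nu}=\sum_{\alpha=1}^n C_{\mu\alpha\nu}\partial_\alpha$. Define linear maps $\psi\colon\mathfrak{g}_h\to\hat{\mathcal{A}}_n$ and $\tilde\psi\colon\tilde{\mathfrak{g}}_h\to\hat{\mathcal{A}}_n$ by $$X_\mu\mapsto\hat x_\mu=\sum_{\alpha=1}^n x_\alpha\,\psi_{\mu\alpha}(\mathbf{C}),\qquad Y_\mu\mapsto\hat y_\mu=\sum_{\alpha=1}^n x_\alpha\,\tilde\psi_{\mu\alpha}(\mathbf{C}),$$ where $\psi(t)=\frac{t}{1-e^{-t}}$ and $\tilde\psi(t)=\frac{t}{e^t-1}$. Then the associated star-products on $\mathcal{X}=\mathbb{K}[x_1,\dots,x_n]$, $$f\star g=\Omega_\psi\big(\Omega_\psi^{-1}(f)\,\Omega_\psi^{-1}(g)\big)\quad\text{and}\quad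 f\,\tilde\star\,g=\Omega_{\tilde\psi}\big(\Omega_{\tilde\psi}^{-1}(f)\,\Omega_{\tilde\psi}^{-1}(g)\big),$$ are left–right dual, i.e. $f\star g=g\,\tilde\star\,f$ for all $f,g\in\mathcal{X}$.
   Context: The Weyl algebra $\mathcal{A}_n$ is the unital associative $\mathbb{K}$-algebra generated by $x_1,\dots,x_n,\partial_1,\dots,\partial_n$ with $[x_\mu,x_\nu]=[\partial_\mu,\partial_\nu]=0$, $[\partial_\mu,x_\nu]=\delta_{\mu\nu}$. $\hat{\mathcal{A}}_n$ is its semicompletion by the order of differential operators: it contains formal power series in the $\partial_\mu$ but only polynomial expressions in the $x_\mu$. The left action $\rhd$ of $\hat{\mathcal{A}}_n$ on $\mathcal{X}$ is given by $x_\mu\rhd f=x_\mu f$, $\partial_\mu\rhd f=\partial f/\partial x_\mu$, $(ab)\rhd f=a\rhd(b\rhd f)$, extended to formal power series in the $\partial_\mu$ in the obvious way. For a formal power series $F(t)=\sum_k f_kt^k$, $F(\mathbf{C})=\sum_kf_k\mathbf{C}^k$, and $F_{\mu\alpha}(\mathbf{C})$ denotes its $(\mu,\alpha)$ entry (a formal power series in $\partial_1,\dots,\partial_n$). A realization of a Lie algebra over $\mathbb{K}$ with basis $Z_1,\dots,Z_n$ and bracket $[Z_\mu,Z_\nu]=\sum_{\alpha=1}^n D_{\mu\nu\alpha}(h)Z_\alpha$, whose structure constants $D_{\mu\nu\alpha}(h)$ depend on a parameter $h\in\mathbb{R}$ with $\lim_{h\to0}D_{\mu\nu\alpha}(h)=0$,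 is a Lie algebra monomorphism $\varphi$ into $\hat{\mathcal{A}}_n$ of the form $\varphi(Z_\mu)=\sum_\alpha x_\alpha\varphi_{\alpha\mu}(\partial)$, with $\varphi_{\alpha\mu}(\partial)$ formal power series in $\partial_1,\dots,\partial_n$ depending on $h$ and $\lim_{h\to0}\varphi_{\alpha\mu}(\partial)=\delta_{\alpha\mu}$. To such a $\varphi$ one associates the unital subalgebra $\widehat{\mathcal{X}}_\varphi\subset\hat{\mathcal{A}}_n$ generated by $\varphi(Z_1),\dots,\varphi(Z_n)$ and the vector space isomorphism $\Omega_\varphi\colon\widehat{\mathcal{X}}_\varphi\to\mathcal{X}$, $\Omega_\varphi(\hat f)=\hat f\rhd1$. The star-product associated with $\varphi$ is $f\star g=\Omega_\varphi(\Omega_\varphi^{-1}(f)\Omega_\varphi^{-1}(g))$. In the claim, $\Omega_\psi$ is defined on the unital subalgebra generated by $\hat x_1,\dots,\hat x_n$, and $\Omega_{\tilde\psi}$ on the one generated by $\hat y_1,\dots,\hat y_n$. *)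

theory Defs
  imports
    "HOL-Analysis.Analysis"
    "HOL-Library.Poly_Mapping"
    "HOL-Computational_Algebra.Formal_Power_Series"
begin

section \<open>Multi-indices and polynomials\<close>

text \<open>A monomial in variables indexed by a finite type is its exponent vector; polynomials are
  finitely supported coefficient functions on monomials, with the convolution product of
  \<^theory>\<open>HOL-Library.Poly_Mapping\<close>.\<close>

type_synonym 'n mindex = "'n \<Rightarrow>\<^sub>0 nat"
type_synonym ('n, 'k) poly_ring = "'n mindex \<Rightarrow>\<^sub>0 'k"

abbreviation lookup where "lookup \<equiv> Poly_Mapping.lookup"
abbreviation unit_index :: "'n \<Rightarrow> 'n mindex" where
  "unit_index i \<equiv> Poly_Mapping.single i (Suc 0)"

definition var :: "'n \<Rightarrow> ('n, 'k::zero_neq_one) poly_ring" where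
  "var i = Poly_Mapping.single (unit_index i) 1"

definition mfact :: "'n::finite mindex \<Rightarrow> nat" where
  "mfact m = (\<Prod>i\<in>UNIV. fact (lookup m i))"

definition mbinom :: "'n::finite mindex \<Rightarrow> 'n mindex \<Rightarrow> nat" where
  "mbinom k e = (\<Prod>i\<in>UNIV. (lookup k i + lookup e i) choose (lookup k i))"

definition adiag :: "'n::finite mindex \<Rightarrow> ('n mindex \<times> 'n mindex) set" where
  "adiag d = {(k, e). k + e = d}"

definition mdeg :: "'n::finite mindex \<Rightarrow> nat" where
  "mdeg m = (\<Sum>i\<in>UNIV. lookup m i)"

lemma mfact_0 [simp]: "mfact 0 = 1"
  by (simp add: mfact_def)

lemma mfact_pos [simp]: "mfact m > 0"
  by (simp add: mfact_def prod_pos)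

lemma mfact_neq0 [simp]: "mfact m \<noteq> 0"
  using mfact_pos[of m] by linarith

lemma mdeg_add: "mdeg (m + m') = mdeg m + mdeg m'"
  by (simp add: mdeg_def lookup_add sum.distrib)

lemma mdeg_eq_0: "mdeg m = 0 \<longleftrightarrow> m = 0"
  by (auto simp: mdeg_def intro: poly_mapping_eqI)

lemma mfact_add_unit: "mfact (m + unit_index i) = mfact m * Suc (lookup m i)"
proof -
  have "mfact (m + unit_index i) = (\<Prod>j\<in>UNIV. fact (lookup m j) * (if j = i then Suc (lookup m i) else 1))"
    unfolding mfact_def
    by (rule prod.cong) (auto simp: lookup_add lookup_single when_def algebra_simps)
  also have "\<dots> = mfact m * Suc (lookup m i)"
    by (simp add: prod.distrib mfact_def)
  finally show ?thesis .
qed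

lemma decomp_unit:
  assumes "lookup m i > 0"
  obtains m' where "m = m' + unit_index i"
proof
  show "m = (m - unit_index i) + unit_index i"
    using assms by (intro poly_mapping_eqI) (auto simp: lookup_add lookup_minus lookup_single when_def)
qed

lemma mindex_induct [case_names zero unit]:
  fixes m :: "'n::finite mindex"
  assumes "P 0" and step: "\<And>m i. P m \<Longrightarrow> P (m + unit_index i)"
  shows "P m"
proof (induction "mdeg m" arbitrary: m)
  case 0
  then show ?case using assms(1) by (simp add: mdeg_eq_0)
next
  case (Suc d)
  then have "m \<noteq> 0" by (metis mdeg_eq_0 nat.distinct(1))
  then obtain i where "lookup m i > 0"
    by (metis gr0I lookup_zero poly_mapping_eqI)
  then obtain m' where m': "m = m' + unit_index i" by (rule decomp_unit)
  have "mdeg (unit_index i) = 1"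
    by (simp add: mdeg_def lookup_single when_def)
  with Suc m' have "d = mdeg m'" by (simp add: mdeg_add)
  with Suc m' step show ?case by simp
qed

lemma finite_mindex_le: "finite {k::'n::finite mindex. \<forall>i. lookup k i \<le> lookup d i}"
proof -
  have "lookup ` {k. \<forall>i. lookup k i \<le> lookup d i} \<subseteq> PiE UNIV (\<lambda>i. {..lookup d i})"
    by auto
  then have "finite (lookup ` {k::'n mindex. \<forall>i. lookup k i \<le> lookup d i})"
    by (rule finite_subset) (auto intro: finite_PiE)
  then show ?thesis
    by (rule finite_imageD) (auto simp: inj_on_def intro: poly_mapping_eqI)
qed

lemma finite_adiag [simp]: "finite (adiag d)"
proof -
  let ?L = "{k. \<forall>i. lookup k i \<le> lookup d i}"
  have "adiag d \<subseteq> ?L \<times> ?L"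
    by (auto simp: adiag_def lookup_add)
  then show ?thesis
    by (rule finite_subset) (simp add: finite_mindex_le)
qed

lemma sum_adiag:
  fixes f :: "'n::finite mindex \<times> 'n mindex \<Rightarrow> 'a::comm_monoid_add"
  assumes "finite T" and "\<And>x. x \<in> U \<Longrightarrow> fst x + snd x \<in> T"
    and "\<And>x. fst x + snd x \<in> T \<Longrightarrow> x \<notin> U \<Longrightarrow> f x = 0"
  shows "(\<Sum>d\<in>T. \<Sum>x\<in>adiag d. f x) = sum f U"
proof -
  have "(\<Sum>d\<in>T. \<Sum>x\<in>adiag d. f x) = sum f (\<Union>d\<in>T. adiag d)"
    using assms(1) by (intro sum.UNION_disjoint[symmetric]) (simp, simp, force simp: adiag_def)
  also have "\<dots> = sum f U"
    using assms by (intro sum.mono_neutral_right) (simp, force simp: adiag_def, force simp: adiag_def)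
  finally show ?thesis .
qed

lemma poly_ring_induct [case_names single add]:
  fixes p :: "'a \<Rightarrow>\<^sub>0 'b::monoid_add"
  assumes "\<And>m c. P (Poly_Mapping.single m c)"
    and "\<And>p q. P p \<Longrightarrow> P q \<Longrightarrow> P (p + q)"
  shows "P p"
proof (induction p rule: update_induct)
  case const
  show ?case using assms(1)[of undefined 0] by simp
next
  case (update f a b)
  have "Poly_Mapping.update a b f = Poly_Mapping.single a b + f"
    using update(1)
    by (intro poly_mapping_eqI)
      (auto simp: lookup_update lookup_add lookup_single when_def in_keys_iff)
  then show ?case using update assms by simp
qed


section \<open>Partial derivatives of polynomials\<close>

text \<open>The operator \<open>\<partial>\<^sup>k\<close> for a multi-index \<open>k\<close>, given by
  \<open>\<partial>\<^sup>k x\<^sup>m\<^sup>+\<^sup>k = ((m + k)! / m!) x\<^sup>m\<close>.\<close>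

lift_definition mderiv ::
  "'n::finite mindex \<Rightarrow> ('n, 'k::field_char_0) poly_ring \<Rightarrow> ('n, 'k) poly_ring"
  is "\<lambda>k p m. of_nat (mfact (m + k)) / of_nat (mfact m) * p (m + k)"
proof -
  fix k :: "'n mindex" and p :: "'n mindex \<Rightarrow> 'k"
  assume fin: "finite {m. p m \<noteq> 0}"
  have "finite ((\<lambda>m. m + k) -` {m. p m \<noteq> 0})"
    by (rule finite_vimageI[OF fin]) (auto simp: inj_def)
  then show "finite {m. of_nat (mfact (m + k)) / of_nat (mfact m) * p (m + k) \<noteq> 0}"
    by (rule finite_subset[rotated]) auto
qed

abbreviation pderiv_var ::
  "'n::finite \<Rightarrow> ('n, 'k::field_char_0) poly_ring \<Rightarrow> ('n, 'k) poly_ring" where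
  "pderiv_var i \<equiv> mderiv (unit_index i)"

lemma mderiv_0 [simp]: "mderiv 0 p = p"
  by (intro poly_mapping_eqI) (simp add: mderiv.rep_eq)

lemma mderiv_zero [simp]: "mderiv k 0 = 0"
  by (intro poly_mapping_eqI) (simp add: mderiv.rep_eq)

lemma mderiv_mderiv: "mderiv k (mderiv k' p) = mderiv (k + k') p"
  by (intro poly_mapping_eqI) (simp add: mderiv.rep_eq algebra_simps)

lemma mderiv_add: "mderiv k (p + q) = mderiv k p + mderiv k q"
  by (intro poly_mapping_eqI) (simp add: mderiv.rep_eq lookup_add algebra_simps)

lemma mderiv_sum: "mderiv k (sum f A) = (\<Sum>x\<in>A. mderiv k (f x))"
  by (induction A rule: infinite_finite_induct) (simp_all add: mderiv_add)

lemma pderiv_var_single: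
  "pderiv_var i (Poly_Mapping.single m c) =
     Poly_Mapping.single (m - unit_index i) (of_nat (lookup m i) * c)"
proof (intro poly_mapping_eqI)
  fix l
  show "lookup (pderiv_var i (Poly_Mapping.single m c)) l =
      lookup (Poly_Mapping.single (m - unit_index i) (of_nat (lookup m i) * c)) l"
  proof (cases "lookup m i = 0")
    case True
    then have "m \<noteq> l + unit_index i"
      by (auto simp: lookup_add)
    with True show ?thesis
      by (simp add: mderiv.rep_eq lookup_single when_def)
  next
    case False
    then obtain m' where m: "m = m' + unit_index i" using decomp_unit[of m i] by blast
    show ?thesis unfolding m
      by (auto simp: mderiv.rep_eq lookup_single when_def mfact_add_unit lookup_add
          simp del: mult_Suc_right)
  qed
qed

lemma pderiv_var_mult:
  "pderiv_var i (p * q) = pderiv_var i p * q + p * pderiv_var i q"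
proof (induction p rule: poly_ring_induct)
  case p: (single m c)
  show ?case
  proof (induction q rule: poly_ring_induct)
    case (single m' c')
    have A: "Poly_Mapping.single (m + m' - unit_index i) (of_nat (lookup m i) * c * c') =
      Poly_Mapping.single (m - unit_index i + m') (of_nat (lookup m i) * c * c')"
    proof (cases "lookup m i = 0")
      case False
      then obtain l where "m = l + unit_index i" using decomp_unit[of m i] by blast
      then show ?thesis by (simp add: add.commute[of _ m'] flip: add.assoc)
    qed simp
    have B: "Poly_Mapping.single (m + m' - unit_index i) (of_nat (lookup m' i) * c * c') =
      Poly_Mapping.single (m + (m' - unit_index i)) (of_nat (lookup m' i) * c * c')"
    proof (cases "lookup m' i = 0")
      case False
      then obtain l where "m' = l + unit_index i" using decomp_unit[of m' i] by blast
      then show ?thesis by (simp flip: add.assoc)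
    qed simp
    from A B show ?case
      by (simp add: mult_single pderiv_var_single lookup_add algebra_simps single_add)
  next
    case (add q r)
    then show ?case by (simp add: mderiv_add algebra_simps)
  qed
next
  case (add p r)
  then show ?case by (simp add: mderiv_add algebra_simps)
qed

lemma mbinom_pascal:
  fixes k e :: "'n::finite mindex"
  assumes "lookup k i + lookup e i > 0"
  shows "mbinom k e = (if lookup k i > 0 then mbinom (k - unit_index i) e else 0)
                    + (if lookup e i > 0 then mbinom k (e - unit_index i) else 0)"
proof -
  define R where "R = (\<Prod>j\<in>UNIV - {i}. (lookup k j + lookup e j) choose (lookup k j))"
  have 1: "mbinom k e = ((lookup k i + lookup e i) choose (lookup k i)) * R"
    unfolding mbinom_def R_def by (subst prod.remove[of _ i]) auto
  have 2: "mbinom (k - unit_index i) e =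
      ((lookup k i - 1 + lookup e i) choose (lookup k i - 1)) * R"
    unfolding mbinom_def R_def
    by (subst prod.remove[of _ i]) (auto simp: lookup_minus lookup_single when_def intro!: prod.cong)
  have 3: "mbinom k (e - unit_index i) =
      ((lookup k i + (lookup e i - 1)) choose (lookup k i)) * R"
    unfolding mbinom_def R_def
    by (subst prod.remove[of _ i]) (auto simp: lookup_minus lookup_single when_def intro!: prod.cong)
  show ?thesis
  proof (cases "lookup k i")
    case 0
    then show ?thesis using assms by (simp add: 1 3)
  next
    case k: (Suc a)
    show ?thesis
    proof (cases "lookup e i")
      case 0
      then show ?thesis using k by (simp add: 1 2)
    next
      case (Suc b)
      then show ?thesis using k by (simp add: 1 2 3 algebra_simps)
    qed
  qed
qed

lemma mderiv_mult:
  fixes p q :: "('n::finite, 'k::field_char_0) poly_ring"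
  shows "mderiv d (p * q) =
    (\<Sum>(k, e)\<in>adiag d. of_nat (mbinom k e) * mderiv k p * mderiv e q)"
proof (induction d arbitrary: p q rule: mindex_induct)
  case zero
  have "adiag (0::'n mindex) = {(0, 0)}"
  proof -
    have "k = 0 \<and> e = 0" if "k + e = 0" for k e :: "'n mindex"
      using that by (metis add_eq_0_iff_both_eq_0 mdeg_add mdeg_eq_0)
    moreover have "(0::'n mindex) + 0 = 0" by simp
    ultimately show ?thesis unfolding adiag_def by blast
  qed
  then show ?case by (simp add: mbinom_def)
next
  case (unit d i)
  let ?u = "unit_index i"
  define F where "F k e = mderiv k p * mderiv e q" for k e
  have "mderiv (d + ?u) (p * q) = mderiv d (pderiv_var i p * q) + mderiv d (p * pderiv_var i q)"
    by (simp add: pderiv_var_mult flip: mderiv_mderiv mderiv_add)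
  also have "\<dots> = (\<Sum>(k, e)\<in>adiag d. of_nat (mbinom k e) * F (k + ?u) e)
      + (\<Sum>(k, e)\<in>adiag d. of_nat (mbinom k e) * F k (e + ?u))"
    by (simp add: unit mderiv_mderiv F_def mult.assoc)
  also have "(\<Sum>(k, e)\<in>adiag d. of_nat (mbinom k e) * F (k + ?u) e) =
      (\<Sum>(k, e)\<in>{(k, e). (k, e) \<in> adiag (d + ?u) \<and> lookup k i > 0}.
         of_nat (mbinom (k - ?u) e) * F k e)"
  proof (rule sum.reindex_bij_witness[where j = "\<lambda>(k, e). (k + ?u, e)" and i = "\<lambda>(k, e). (k - ?u, e)"])
    fix x assume "x \<in> {(k, e). (k, e) \<in> adiag (d + ?u) \<and> lookup k i > 0}"
    then obtain k e where x: "x = (k, e)" "k + e = d + ?u" "lookup k i > 0"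
      by (auto simp: adiag_def)
    then obtain k' where k': "k = k' + ?u" using decomp_unit[of k i] by blast
    have "k' + e + ?u = d + ?u" using x k' by (simp add: ac_simps)
    then have "k' + e = d" by simp
    then show "(case x of (k, e) \<Rightarrow> (k - ?u, e)) \<in> adiag d"
      and "(case case x of (k, e) \<Rightarrow> (k - ?u, e) of (k, e) \<Rightarrow> (k + ?u, e)) = x"
      using x k' by (simp_all add: adiag_def)
  qed (auto simp: adiag_def lookup_add ac_simps)
  also have "\<dots> = (\<Sum>(k, e)\<in>adiag (d + ?u).
      of_nat (if lookup k i > 0 then mbinom (k - ?u) e else 0) * F k e)"
    by (rule sum.mono_neutral_cong_left) (auto split: if_splits)
  also have "(\<Sum>(k, e)\<in>adiag d. of_nat (mbinom k e) * F k (e + ?u)) =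
      (\<Sum>(k, e)\<in>{(k, e). (k, e) \<in> adiag (d + ?u) \<and> lookup e i > 0}.
         of_nat (mbinom k (e - ?u)) * F k e)"
  proof (rule sum.reindex_bij_witness[where j = "\<lambda>(k, e). (k, e + ?u)" and i = "\<lambda>(k, e). (k, e - ?u)"])
    fix x assume "x \<in> {(k, e). (k, e) \<in> adiag (d + ?u) \<and> lookup e i > 0}"
    then obtain k e where x: "x = (k, e)" "k + e = d + ?u" "lookup e i > 0"
      by (auto simp: adiag_def)
    then obtain e' where e': "e = e' + ?u" using decomp_unit[of e i] by blast
    have "k + e' + ?u = d + ?u" using x e' by (simp add: ac_simps)
    then have "k + e' = d" by simp
    then show "(case x of (k, e) \<Rightarrow> (k, e - ?u)) \<in> adiag d"
      and "(case case x of (k, e) \<Rightarrow> (k, e - ?u) of (k, e) \<Rightarrow> (k, e + ?u)) = x"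
      using x e' by (simp_all add: adiag_def)
  qed (auto simp: adiag_def lookup_add ac_simps)
  also have "\<dots> = (\<Sum>(k, e)\<in>adiag (d + ?u).
      of_nat (if lookup e i > 0 then mbinom k (e - ?u) else 0) * F k e)"
    by (rule sum.mono_neutral_cong_left) (auto split: if_splits)
  also have "(\<Sum>(k, e)\<in>adiag (d + ?u).
        of_nat (if lookup k i > 0 then mbinom (k - ?u) e else 0) * F k e) + \<dots> =
      (\<Sum>(k, e)\<in>adiag (d + ?u). of_nat (mbinom k e) * F k e)"
    unfolding sum.distrib[symmetric]
  proof (rule sum.cong[OF refl])
    fix x assume "x \<in> adiag (d + ?u)"
    then obtain k e where x: "x = (k, e)" "k + e = d + ?u" by (auto simp: adiag_def)
    have "lookup k i + lookup e i > 0"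
      using arg_cong[OF x(2), of "\<lambda>m. lookup m i"] by (simp add: lookup_add)
    from mbinom_pascal[OF this]
    show "(case x of (k, e) \<Rightarrow> of_nat (if lookup k i > 0 then mbinom (k - ?u) e else 0) * F k e) +
        (case x of (k, e) \<Rightarrow> of_nat (if lookup e i > 0 then mbinom k (e - ?u) else 0) * F k e) =
        (case x of (k, e) \<Rightarrow> of_nat (mbinom k e) * F k e)"
      by (simp only: x prod.case of_nat_add distrib_right)
  qed
  finally show ?case by (simp add: F_def mult.assoc)
qed

definition dsupp :: "('n::finite, 'k::field_char_0) poly_ring \<Rightarrow> 'n mindex set" where
  "dsupp p = {k. \<exists>m. k + m \<in> Poly_Mapping.keys p}"

lemma finite_dsupp [simp]: "finite (dsupp p)"
proof -
  have "dsupp p \<subseteq> fst ` (\<Union>m\<in>Poly_Mapping.keys p. adiag m)"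
    by (force simp: dsupp_def adiag_def)
  then show ?thesis by (rule finite_subset) auto
qed

lemma mderiv_outside: "k \<notin> dsupp p \<Longrightarrow> mderiv k p = 0"
  by (intro poly_mapping_eqI) (auto simp: mderiv.rep_eq dsupp_def in_keys_iff add.commute)

lemma dsupp_add: "k + e \<in> dsupp p \<Longrightarrow> k \<in> dsupp p \<and> e \<in> dsupp p"
  by (auto simp: dsupp_def) (metis add.assoc, metis add.assoc add.commute)


section \<open>The semicompleted Weyl algebra\<close>

text \<open>Elements are normally ordered series \<open>\<Sum>\<^sub>d p\<^sub>d(x) \<partial>\<^sup>d\<close> with arbitrary polynomial coefficients
  \<open>p\<^sub>d\<close>: the completion of the Weyl algebra (with its basis \<open>x\<^sup>m \<partial>\<^sup>d\<close>) with respect to the order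
  in \<open>\<partial>\<close>.\<close>

typedef (overloaded) ('n, 'k) weyl = "UNIV :: ('n::finite mindex \<Rightarrow> ('n, 'k::field_char_0) poly_ring) set"
  morphisms dcoeff Weyl
  by simp

setup_lifting type_definition_weyl

lemma weyl_eqI: "(\<And>d. dcoeff a d = dcoeff b d) \<Longrightarrow> a = b"
  by (auto simp: dcoeff_inject[symmetric])

instantiation weyl :: (finite, field_char_0) ab_group_add
begin
lift_definition zero_weyl :: "('a, 'b) weyl" is "\<lambda>d. 0" .
lift_definition plus_weyl :: "('a, 'b) weyl \<Rightarrow> ('a, 'b) weyl \<Rightarrow> ('a, 'b) weyl"
  is "\<lambda>a b d. a d + b d" .
lift_definition minus_weyl :: "('a, 'b) weyl \<Rightarrow> ('a, 'b) weyl \<Rightarrow> ('a, 'b) weyl"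
  is "\<lambda>a b d. a d - b d" .
lift_definition uminus_weyl :: "('a, 'b) weyl \<Rightarrow> ('a, 'b) weyl"
  is "\<lambda>a d. - a d" .
instance
  by standard (transfer; simp add: algebra_simps)+
end

text \<open>The product is forced by \<open>\<partial>\<^sup>b q = \<Sum>\<^sub>k\<^sub>+\<^sub>e\<^sub>=\<^sub>b (b choose k) (\<partial>\<^sup>k q) \<partial>\<^sup>e\<close> for a polynomial \<open>q\<close>. The
  sum over \<open>k\<close> is finite since high derivatives of the polynomial \<open>b g\<close> vanish.\<close>

instantiation weyl :: (finite, field_char_0) "{one, times}"
begin
lift_definition one_weyl :: "('a, 'b) weyl" is "\<lambda>d. if d = 0 then 1 else 0" .
lift_definition times_weyl :: "('a, 'b) weyl \<Rightarrow> ('a, 'b) weyl \<Rightarrow> ('a, 'b) weyl"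
  is "\<lambda>a b d. \<Sum>(e, g)\<in>adiag d.
        Sum_any (\<lambda>k. of_nat (mbinom k e) * a (k + e) * mderiv k (b g))" .
instance ..
end

text \<open>The action on polynomials; the sum over \<open>d\<close> is finite for each polynomial.\<close>

definition act :: "('n::finite, 'k::field_char_0) weyl \<Rightarrow> ('n, 'k) poly_ring \<Rightarrow> ('n, 'k) poly_ring"
    (infixr \<open>\<rhd>\<close> 72) where
  "a \<rhd> p = Sum_any (\<lambda>d. dcoeff a d * mderiv d p)"

lemma act_eq_sum:
  assumes "finite S" "dsupp p \<subseteq> S"
  shows "a \<rhd> p = (\<Sum>d\<in>S. dcoeff a d * mderiv d p)"
  unfolding act_def
  by (rule Sum_any.expand_superset) (use assms mderiv_outside in force)+

lemma act_add: "(a + b) \<rhd> p = a \<rhd> p + b \<rhd> p"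
  by (simp add: act_eq_sum[OF finite_dsupp order.refl] plus_weyl.rep_eq distrib_right sum.distrib)

lemma act_diff: "(a - b) \<rhd> p = a \<rhd> p - b \<rhd> p"
  by (simp add: act_eq_sum[OF finite_dsupp order.refl] minus_weyl.rep_eq left_diff_distrib sum_subtractf)

lemma act_add_right: "a \<rhd> (p + q) = a \<rhd> p + a \<rhd> q"
proof -
  let ?S = "dsupp p \<union> dsupp q \<union> dsupp (p + q)"
  have "a \<rhd> r = (\<Sum>d\<in>?S. dcoeff a d * mderiv d r)" if "r \<in> {p, q, p + q}" for r
    by (rule act_eq_sum) (use that in auto)
  then show ?thesis by (simp add: mderiv_add distrib_left sum.distrib)
qed

lemma act_zero [simp]: "0 \<rhd> p = 0"
  by (simp add: act_def zero_weyl.rep_eq)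

lemma act_one [simp]: "1 \<rhd> p = p"
proof -
  have "1 \<rhd> p = (\<Sum>d\<in>insert 0 (dsupp p). dcoeff 1 d * mderiv d p)"
    by (rule act_eq_sum) auto
  also have "\<dots> = (\<Sum>d\<in>insert 0 (dsupp p). if d = 0 then p else 0)"
    by (rule sum.cong) (auto simp: one_weyl.rep_eq)
  finally show ?thesis by simp
qed

lemma act_mult: "(a * b) \<rhd> p = a \<rhd> (b \<rhd> p)"
proof -
  define B where "B = dsupp p"
  define K where "K = (\<Union>g\<in>B. dsupp (dcoeff b g))"
  have fin: "finite B" "finite K" by (auto simp: B_def K_def)
  define f where "f k e g = of_nat (mbinom k e) * dcoeff a (k + e)
    * mderiv k (dcoeff b g) * mderiv (e + g) p" for k e g
  define q where "q = b \<rhd> p"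
  have q: "q = (\<Sum>g\<in>B. dcoeff b g * mderiv g p)"
    unfolding q_def by (rule act_eq_sum) (auto simp: B_def)
  have f0: "f k e g = 0" if "g \<in> B" "k \<notin> K \<or> e \<notin> B \<or> e + g \<notin> B" for k e g
  proof -
    have "mderiv k (dcoeff b g) = 0 \<or> mderiv (e + g) p = 0"
      using that mderiv_outside[of k "dcoeff b g"] mderiv_outside[of "e + g" p] dsupp_add[of e g p]
      by (auto simp: K_def B_def)
    then show ?thesis by (auto simp: f_def)
  qed

  have "(a * b) \<rhd> p = (\<Sum>d\<in>B. dcoeff (a * b) d * mderiv d p)"
    by (rule act_eq_sum) (auto simp: B_def)
  also have "\<dots> = (\<Sum>d\<in>B. \<Sum>x\<in>adiag d. \<Sum>k\<in>K. f k (fst x) (snd x))"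
  proof (rule sum.cong[OF refl])
    fix d assume d: "d \<in> B"
    have "(\<Sum>(e, g)\<in>adiag d. Sum_any (\<lambda>k. of_nat (mbinom k e) * dcoeff a (k + e) * mderiv k (dcoeff b g)))
      = (\<Sum>(e, g)\<in>adiag d. \<Sum>k\<in>K. of_nat (mbinom k e) * dcoeff a (k + e) * mderiv k (dcoeff b g))"
    proof (intro sum.cong[OF refl], clarify)
      fix e g assume "(e, g) \<in> adiag d"
      then have "g \<in> B" using d dsupp_add by (auto simp: adiag_def B_def)
      then have "mderiv k (dcoeff b g) = 0" if "k \<notin> K" for k
        using that mderiv_outside by (auto simp: K_def)
      then show "Sum_any (\<lambda>k. of_nat (mbinom k e) * dcoeff a (k + e) * mderiv k (dcoeff b g)) =
          (\<Sum>k\<in>K. of_nat (mbinom k e) * dcoeff a (k + e) * mderiv k (dcoeff b g))"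
        by (intro Sum_any.expand_superset fin) (use mult_zero_right in force)
    qed
    then have "dcoeff (a * b) d * mderiv d p =
      (\<Sum>(e, g)\<in>adiag d. \<Sum>k\<in>K. of_nat (mbinom k e) * dcoeff a (k + e) * mderiv k (dcoeff b g)) * mderiv d p"
      by (simp add: times_weyl.rep_eq)
    also have "\<dots> = (\<Sum>x\<in>adiag d. \<Sum>k\<in>K. f k (fst x) (snd x))"
      unfolding sum_distrib_right
      by (rule sum.cong) (auto simp: f_def adiag_def sum_distrib_right)
    finally show "dcoeff (a * b) d * mderiv d p = (\<Sum>x\<in>adiag d. \<Sum>k\<in>K. f k (fst x) (snd x))" .
  qed
  also have "\<dots> = (\<Sum>x\<in>{x \<in> B \<times> B. fst x + snd x \<in> B}. \<Sum>k\<in>K. f k (fst x) (snd x))"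
    by (rule sum_adiag) (use fin in \<open>auto simp: B_def dest: dsupp_add\<close>)
  also have "\<dots> = (\<Sum>x\<in>B \<times> B. \<Sum>k\<in>K. f k (fst x) (snd x))"
    using fin by (intro sum.mono_neutral_left ballI sum.neutral) (simp, blast, use f0 in force)
  also have "\<dots> = (\<Sum>e\<in>B. \<Sum>g\<in>B. \<Sum>k\<in>K. f k e g)"
    using sum.cartesian_product[of "\<lambda>e g. \<Sum>k\<in>K. f k e g" B B]
    by (simp only: case_prod_unfold)
  also have "\<dots> = (\<Sum>e\<in>B. \<Sum>k\<in>K. \<Sum>g\<in>B. f k e g)"
    by (rule sum.cong[OF refl], rule sum.swap)
  also have "\<dots> = (\<Sum>k\<in>K. \<Sum>e\<in>B. \<Sum>g\<in>B. f k e g)"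
    by (rule sum.swap)
  also have "\<dots> = (\<Sum>x\<in>K \<times> B. \<Sum>g\<in>B. f (fst x) (snd x) g)"
    using sum.cartesian_product[of "\<lambda>k e. \<Sum>g\<in>B. f k e g" B K]
    by (simp only: case_prod_unfold)
  finally have L: "(a * b) \<rhd> p = (\<Sum>x\<in>K \<times> B. \<Sum>g\<in>B. f (fst x) (snd x) g)" .

  define T where "T = (\<lambda>x. fst x + snd x) ` (K \<times> B) \<union> dsupp q"
  have finT: "finite T" using fin by (auto simp: T_def)
  have "a \<rhd> q = (\<Sum>d\<in>T. dcoeff a d * mderiv d q)"
    by (rule act_eq_sum[OF finT]) (auto simp: T_def)
  also have "\<dots> = (\<Sum>d\<in>T. \<Sum>x\<in>adiag d. \<Sum>g\<in>B. f (fst x) (snd x) g)"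
  proof (rule sum.cong[OF refl])
    fix d
    have "dcoeff a d * mderiv d q = (\<Sum>g\<in>B. \<Sum>x\<in>adiag d. f (fst x) (snd x) g)"
      unfolding q mderiv_sum mderiv_mult mderiv_mderiv sum_distrib_left
      by (intro sum.cong) (auto simp: f_def adiag_def algebra_simps)
    also have "\<dots> = (\<Sum>x\<in>adiag d. \<Sum>g\<in>B. f (fst x) (snd x) g)"
      by (rule sum.swap)
    finally show "dcoeff a d * mderiv d q = (\<Sum>x\<in>adiag d. \<Sum>g\<in>B. f (fst x) (snd x) g)" .
  qed
  also have "\<dots> = (\<Sum>x\<in>K \<times> B. \<Sum>g\<in>B. f (fst x) (snd x) g)"
  proof (rule sum_adiag[OF finT])
    fix x assume "x \<notin> K \<times> B"
    then show "(\<Sum>g\<in>B. f (fst x) (snd x) g) = 0"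
      by (intro sum.neutral) (use f0 in \<open>auto simp: mem_Times_iff\<close>)
  qed (auto simp: T_def)
  finally show ?thesis by (simp add: L q_def)
qed

lemma mderiv_self: "mderiv d (Poly_Mapping.single d 1) = Poly_Mapping.single 0 (of_nat (mfact d))"
  by (intro poly_mapping_eqI) (auto simp: mderiv.rep_eq lookup_single when_def simp del: single_of_nat)

lemma act_faithful0:
  fixes a :: "('n::finite, 'k::field_char_0) weyl"
  assumes "\<And>p. a \<rhd> p = 0"
  shows "a = 0"
proof -
  have "dcoeff a d = 0" for d
  proof (induction "mdeg d" arbitrary: d rule: less_induct)
    case less
    let ?p = "Poly_Mapping.single d 1 :: ('n, 'k) poly_ring"
    have z: "dcoeff a k * mderiv k ?p = 0" if "k \<noteq> d" for k
    proof (cases "mdeg k < mdeg d")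
      case True
      then show ?thesis using less by simp
    next
      case False
      have "k \<notin> dsupp ?p"
      proof
        assume "k \<in> dsupp ?p"
        then obtain m where "k + m = d" by (auto simp: dsupp_def)
        with False have "mdeg m = 0" using mdeg_add[of k m] by simp
        with \<open>k + m = d\<close> \<open>k \<noteq> d\<close> show False by (simp add: mdeg_eq_0)
      qed
      then show ?thesis by (simp add: mderiv_outside)
    qed
    have "0 = a \<rhd> ?p" using assms by simp
    also have "\<dots> = (\<Sum>k\<in>insert d (dsupp ?p). dcoeff a k * mderiv k ?p)"
      by (rule act_eq_sum) auto
    also have "\<dots> = dcoeff a d * Poly_Mapping.single 0 (of_nat (mfact d))"
      by (subst sum.remove[of _ d]) (auto simp: mderiv_self z)
    finally have "0 = dcoeff a d * Poly_Mapping.single 0 (of_nat (mfact d))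
        * Poly_Mapping.single 0 (1 / of_nat (mfact d))" by simp
    then show ?case by (simp add: mult.assoc mult_single del: single_of_nat)
  qed
  then show ?thesis by (intro weyl_eqI) (simp add: zero_weyl.rep_eq)
qed

lemma act_faithful:
  assumes "\<And>p. a \<rhd> p = b \<rhd> p"
  shows "a = b"
  using act_faithful0[of "a - b"] assms by (simp add: act_diff)

instance weyl :: (finite, field_char_0) ring_1
proof
  fix a b c :: "('a, 'b) weyl"
  show "a * b * c = a * (b * c)" "1 * a = a" "a * 1 = a"
    "(a + b) * c = a * c + b * c" "a * (b + c) = a * b + a * c"
    by (auto intro!: act_faithful simp: act_mult act_add act_add_right)
  show "(0::('a, 'b) weyl) \<noteq> 1"
    by (metis one_weyl.rep_eq zero_neq_one zero_weyl.rep_eq)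
qed

lift_definition weyl_scale :: "'k \<Rightarrow> ('n::finite, 'k::field_char_0) weyl \<Rightarrow> ('n, 'k) weyl"
  is "\<lambda>c a d. Poly_Mapping.single 0 c * a d" .

lemma vector_space_weyl_scale: "vector_space weyl_scale"
  by (unfold_locales; transfer) (auto simp: algebra_simps single_add mult_single fun_eq_iff simp flip: mult.assoc)

lift_definition weyl_x :: "'n::finite \<Rightarrow> ('n, 'k::field_char_0) weyl"
  is "\<lambda>i d. if d = 0 then var i else 0" .

lift_definition weyl_d :: "'n::finite \<Rightarrow> ('n, 'k::field_char_0) weyl"
  is "\<lambda>i d. if d = unit_index i then 1 else 0" .

lemma act_x: "weyl_x i \<rhd> p = var i * p"
proof -
  have "weyl_x i \<rhd> p = (\<Sum>d\<in>insert 0 (dsupp p). dcoeff (weyl_x i) d * mderiv d p)"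
    by (rule act_eq_sum) auto
  also have "\<dots> = (\<Sum>d\<in>insert 0 (dsupp p). if d = 0 then var i * p else 0)"
    by (rule sum.cong) (auto simp: weyl_x.rep_eq)
  finally show ?thesis by simp
qed

lemma act_d: "weyl_d i \<rhd> p = pderiv_var i p"
proof -
  have "weyl_d i \<rhd> p = (\<Sum>d\<in>insert (unit_index i) (dsupp p). dcoeff (weyl_d i) d * mderiv d p)"
    by (rule act_eq_sum) auto
  also have "\<dots> = (\<Sum>d\<in>insert (unit_index i) (dsupp p). if d = unit_index i then pderiv_var i p else 0)"
    by (rule sum.cong) (auto simp: weyl_d.rep_eq)
  finally show ?thesis by simp
qed

lemma pderiv_var_var: "pderiv_var i (var j) = (if i = j then 1 else 0)"
  by (auto simp: var_def pderiv_var_single lookup_single when_def)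

lemma weyl_relations:
  "weyl_x i * weyl_x j - weyl_x j * weyl_x i = (0 :: ('n::finite, 'k::field_char_0) weyl)"
  "weyl_d i * weyl_d j - weyl_d j * weyl_d i = (0 :: ('n, 'k) weyl)"
  "weyl_d i * weyl_x j - weyl_x j * weyl_d i = (if i = j then 1 else 0 :: ('n, 'k) weyl)"
  by (rule act_faithful, simp add: act_diff act_mult act_x act_d mderiv_mderiv
        pderiv_var_mult pderiv_var_var add.commute mult.left_commute)+


section \<open>Matrices over the Weyl algebra and formal power series\<close>

primrec matpow :: "'a::semiring_1^'n^'n::finite \<Rightarrow> nat \<Rightarrow> 'a^'n^'n" where
  "matpow A 0 = mat 1"
| "matpow A (Suc k) = A ** matpow A k"

text \<open>The matrix \<open>F(A) = \<Sum>\<^sub>k f\<^sub>k A\<^sup>k\<close>, each entry being summed coefficientwise as a formal series. This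
  is meaningful if each coefficient receives only finitely many nonzero contributions, e.g. if
  all entries of \<open>A\<close> are linear forms in the \<open>\<partial>\<^sub>i\<close>, so that \<open>A\<^sup>k\<close> contributes in order \<open>k\<close> only.\<close>

definition fps_matrix ::
  "'k::field_char_0 fps \<Rightarrow> ('n::finite, 'k) weyl^'n^'n \<Rightarrow> ('n, 'k) weyl^'n^'n" where
  "fps_matrix F A = (\<chi> i j. Weyl (\<lambda>d.
     Sum_any (\<lambda>k. dcoeff (weyl_scale (fps_nth F k) (matpow A k $ i $ j)) d)))"

definition struct_matrix ::
  "('n \<Rightarrow> 'n \<Rightarrow> 'n \<Rightarrow> 'k::field_char_0) \<Rightarrow> ('n::finite, 'k) weyl^'n^'n" where
  "struct_matrix C = (\<chi> i j. \<Sum>a\<in>UNIV. weyl_scale (C i a j) (weyl_d a))"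

definition psi_fps :: "'k::field_char_0 fps" where
  "psi_fps = fps_X / (1 - fps_exp (-1))"

lemma psi_fps_eq: "psi_fps * (1 - fps_exp (-1)) = (fps_X :: 'k::field_char_0 fps)"
proof -
  have "fps_nth (1 - fps_exp (-1) :: 'k fps) 0 = 0" "fps_nth (1 - fps_exp (-1) :: 'k fps) 1 \<noteq> 0"
    by simp_all
  then have "subdegree (1 - fps_exp (-1) :: 'k fps) = 1" "(1 - fps_exp (-1) :: 'k fps) \<noteq> 0"
    by (auto intro!: subdegreeI)
  then show ?thesis by (simp add: psi_fps_def fps_divide_times_eq fps_dvd_iff)
qed

definition psi_tilde_fps :: "'k::field_char_0 fps" where
  "psi_tilde_fps = fps_X / (fps_exp 1 - 1)"

lemma psi_tilde_fps_eq: "psi_tilde_fps * (fps_exp 1 - 1) = (fps_X :: 'k::field_char_0 fps)"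
proof -
  have "fps_nth (fps_exp 1 - 1 :: 'k fps) 0 = 0" "fps_nth (fps_exp 1 - 1 :: 'k fps) 1 \<noteq> 0"
    by simp_all
  then have "subdegree (fps_exp 1 - 1 :: 'k fps) = 1" "(fps_exp 1 - 1 :: 'k fps) \<noteq> 0"
    by (auto intro!: subdegreeI)
  then show ?thesis by (simp add: psi_tilde_fps_def fps_divide_times_eq fps_dvd_iff)
qed


section \<open>Lie algebras and star-products\<close>

text \<open>Where the ground field has to be the real or the complex numbers, the sort
  \<^class>\<open>real_normed_field\<close> is used: both are instances, and by the Gelfand--Mazur theorem every
  instance is isomorphic to one of them.\<close>

locale lie_algebra = vector_space sc
  for sc :: "'k::field \<Rightarrow> 'g::ab_group_add \<Rightarrow> 'g" +
  fixes bracket :: "'g \<Rightarrow> 'g \<Rightarrow> 'g"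
  assumes linear_left: "Vector_Spaces.linear sc sc (\<lambda>u. bracket u v)"
    and linear_right: "Vector_Spaces.linear sc sc (bracket u)"
    and alternating: "bracket u u = 0"
    and jacobi: "bracket u (bracket v w) + bracket v (bracket w u) + bracket w (bracket u v) = 0"

definition is_basis :: "('k::field \<Rightarrow> 'g::ab_group_add \<Rightarrow> 'g) \<Rightarrow> ('i \<Rightarrow> 'g) \<Rightarrow> bool" where
  "is_basis sc B \<longleftrightarrow>
     inj B \<and> \<not> module.dependent sc (range B) \<and> module.span sc (range B) = UNIV"

inductive_set unital_subalgebra ::
  "('n::finite, 'k::field_char_0) weyl set \<Rightarrow> ('n, 'k) weyl set"
  for S :: "('n, 'k) weyl set" where
  gen: "a \<in> S \<Longrightarrow> a \<in> unital_subalgebra S"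
| one: "1 \<in> unital_subalgebra S"
| add: "a \<in> unital_subalgebra S \<Longrightarrow> b \<in> unital_subalgebra S \<Longrightarrow> a + b \<in> unital_subalgebra S"
| mult: "a \<in> unital_subalgebra S \<Longrightarrow> b \<in> unital_subalgebra S \<Longrightarrow> a * b \<in> unital_subalgebra S"
| scale: "a \<in> unital_subalgebra S \<Longrightarrow> weyl_scale c a \<in> unital_subalgebra S"

text \<open>\<open>\<Omega>\<^sub>\<phi>\<close> and the star-product, for a family \<open>u\<close> of generators \<open>\<phi>(Z\<^sub>i)\<close>; the inverse is that of the
  restriction of \<open>\<Omega>\<close> to the subalgebra generated by \<open>u\<close>.\<close>

definition Omega :: "('n::finite, 'k::field_char_0) weyl \<Rightarrow> ('n, 'k) poly_ring" where
  "Omega a = a \<rhd> 1"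

definition Omega_inv ::
  "('n \<Rightarrow> ('n::finite, 'k::field_char_0) weyl) \<Rightarrow> ('n, 'k) poly_ring \<Rightarrow> ('n, 'k) weyl" where
  "Omega_inv u = inv_into (unital_subalgebra (range u)) Omega"

definition star_product ::
  "('n \<Rightarrow> ('n::finite, 'k::field_char_0) weyl) \<Rightarrow>
   ('n, 'k) poly_ring \<Rightarrow> ('n, 'k) poly_ring \<Rightarrow> ('n, 'k) poly_ring" where
  "star_product u f g = Omega (Omega_inv u f * Omega_inv u g)"

end

theory Submission
  imports Defs
begin

text \<open>The generators of the two realizations commute and each subalgebra maps onto the polynomials
  under \<open>\<Omega>\<close>. Hence, with \<open>F\<close>, \<open>G\<close> the preimages of \<open>f\<close>, \<open>g\<close> in the first subalgebra and \<open>F'\<close>, \<open>G'\<close>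
  those in the second, \<open>f \<star> g = F \<rhd> g = F G' \<rhd> 1 = G' F \<rhd> 1 = G' \<rhd> f = G' F' \<rhd> 1\<close>.

  For the commutation, write \<open>[v, w]\<close> for the Lie bracket extended bilinearly to row vectors over the
  polynomials in \<open>\<partial>\<close>. Then \<open>v C = [v, \<Sum>\<^sub>a \<partial>\<^sub>a e\<^sub>a]\<close>, so by the Jacobi identity \<open>C\<close> is a
  derivation of this bracket: if \<open>a\<close> and \<open>b\<close> denote \<open>C\<close> acting on the left and on the right argument,
  then \<open>C\<close> acts on the bracket as \<open>a + b\<close>. Differentiating the powers of \<open>C\<close> turns the commutator of
  the \<open>\<mu>\<close>-th and the \<open>\<nu>\<close>-th generator into
  \<open>(\<psi>(a + b) - \<psi>(a)) \<psi>'(b) / b + (\<psi>'(a + b) - \<psi>'(b)) \<psi>(a) / a\<close> applied to \<open>[e\<^sub>\<mu>, e\<^sub>\<nu>]\<close>, where \<open>\<psi>'\<close> is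
  the second generating function, and this power series in \<open>a\<close> and \<open>b\<close> is zero. Everything is graded by the
  order in \<open>\<partial>\<close>, and on a given polynomial only finitely many orders act nontrivially.\<close>

section \<open>Constant-coefficient differential operators\<close>

abbreviation pconst :: "'k \<Rightarrow> ('n, 'k::zero) poly_ring" where
  "pconst c \<equiv> Poly_Mapping.single 0 c"

lemma pconst_mult: "pconst (c * d) = pconst c * (pconst d :: ('n, 'k::semiring_0) poly_ring)"
  by (simp add: mult_single)

lemma pconst_sum: "pconst (sum f S) = (\<Sum>x\<in>S. pconst (f x) :: ('n, 'k::ab_group_add) poly_ring)"
  by (induction S rule: infinite_finite_induct) (simp_all add: single_add)

lemma lookup_pconst_mult:
  "lookup (pconst c * p) m = c * lookup (p :: ('n, 'k::ring_1) poly_ring) m"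
  by (induction p rule: poly_ring_induct)
    (auto simp: mult_single lookup_single when_def lookup_add algebra_simps)

lemma mderiv_pconst_mult: "mderiv k (pconst c * p) = pconst c * mderiv k p"
  by (intro poly_mapping_eqI) (simp add: mderiv.rep_eq lookup_pconst_mult)

lemma act_pconst_mult: "a \<rhd> (pconst c * p) = pconst c * (a \<rhd> p)"
proof -
  let ?S = "dsupp p \<union> dsupp (pconst c * p)"
  have "a \<rhd> r = (\<Sum>d\<in>?S. dcoeff a d * mderiv d r)" if "r \<in> {p, pconst c * p}" for r
    by (rule act_eq_sum) (use that in auto)
  then show ?thesis
    by (simp add: mderiv_pconst_mult sum_distrib_left mult.left_commute)
qed

lemma act_zero_right [simp]: "a \<rhd> 0 = 0"
  using act_add_right[of a 0 0] by simp

lemma act_sum_right: "a \<rhd> (sum f S) = (\<Sum>x\<in>S. a \<rhd> f x)"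
  by (induction S rule: infinite_finite_induct) (simp_all add: act_add_right)

lemma act_sum: "sum f S \<rhd> p = (\<Sum>x\<in>S. f x \<rhd> p)"
  by (induction S rule: infinite_finite_induct) (simp_all add: act_add)

lemma act_weyl_scale: "weyl_scale c a \<rhd> p = pconst c * (a \<rhd> p)"
  by (simp add: act_eq_sum[OF finite_dsupp order.refl] weyl_scale.rep_eq sum_distrib_left mult.assoc)

text \<open>Operators in the commuting symbols \<partial>_i are encoded by the same ring as
  polynomials in x, \<open>var i\<close> standing for \<partial>_i, so that products, derivatives
  and degrees of \<open>poly_ring\<close> apply to them.\<close>

definition diffop :: "('n::finite, 'k::field_char_0) poly_ring \<Rightarrow> ('n, 'k) weyl" where
  "diffop q = Weyl (\<lambda>d. pconst (lookup q d))"

lemma dcoeff_diffop [simp]: "dcoeff (diffop q) d = pconst (lookup q d)"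
  by (simp add: diffop_def Weyl_inverse)

lemma diffop_0 [simp]: "diffop 0 = 0"
  by (rule weyl_eqI) (simp add: zero_weyl.rep_eq)

lemma diffop_add: "diffop (q + r) = diffop q + diffop r"
  by (rule weyl_eqI) (simp add: plus_weyl.rep_eq lookup_add single_add)

lemma diffop_diff: "diffop (q - r) = diffop q - diffop r"
  by (rule weyl_eqI) (simp add: minus_weyl.rep_eq lookup_minus single_diff)

lemma diffop_sum: "diffop (sum f S) = (\<Sum>x\<in>S. diffop (f x))"
  by (induction S rule: infinite_finite_induct) (simp_all add: diffop_add)

lemma act_diffop: "diffop q \<rhd> p = (\<Sum>d\<in>dsupp p. pconst (lookup q d) * mderiv d p)"
  by (simp add: act_eq_sum[OF finite_dsupp order.refl] dcoeff_diffop)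

lemma act_diffop_single: "diffop (Poly_Mapping.single m c) \<rhd> p = pconst c * mderiv m p"
proof -
  have "diffop (Poly_Mapping.single m c) \<rhd> p =
      (\<Sum>d\<in>insert m (dsupp p). dcoeff (diffop (Poly_Mapping.single m c)) d * mderiv d p)"
    by (rule act_eq_sum) auto
  also have "\<dots> = (\<Sum>d\<in>insert m (dsupp p). if d = m then pconst c * mderiv m p else 0)"
    by (rule sum.cong) (auto simp: dcoeff_diffop lookup_single when_def)
  finally show ?thesis by simp
qed

text \<open>The action is faithful, and on single monomials both sides act as iterated derivatives;
  bilinearity does the rest.\<close>

lemma diffop_mult: "diffop (q * r) = diffop q * diffop r"
proof (induction q rule: poly_ring_induct)
  case q: (single m c)
  show ?case
  proof (induction r rule: poly_ring_induct)
    case (single m' c')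
    show ?case
      by (rule act_faithful)
        (simp add: act_mult act_diffop_single mderiv_pconst_mult mderiv_mderiv
          mult_single[of m c] pconst_mult mult.assoc)
  next
    case (add q r)
    then show ?case by (simp add: diffop_add algebra_simps)
  qed
next
  case (add p q)
  then show ?case by (simp add: diffop_add algebra_simps)
qed

lemma diffop_1 [simp]: "diffop 1 = 1"
  by (rule act_faithful) (simp add: act_diffop_single[of 0 1, unfolded single_one])

lemma diffop_var: "diffop (var i) = weyl_d i"
  by (rule act_faithful) (simp add: act_diffop_single act_d var_def)

lemma diffop_pconst_mult: "diffop (pconst c * q) = weyl_scale c (diffop q)"
  by (rule act_faithful) (simp add: diffop_mult act_mult act_diffop_single act_weyl_scale)

lemma diffop_commute: "diffop q * diffop r = diffop r * diffop q"
  by (simp add: mult.commute flip: diffop_mult)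

lemma weyl_x_commute: "weyl_x i * weyl_x j = weyl_x j * (weyl_x i :: ('n::finite, 'k::field_char_0) weyl)"
  using weyl_relations(1)[of i j] by simp

text \<open>The commutator with x_i differentiates formally with respect to \<partial>_i: the
  Leibniz rule, one factor \<partial>_j at a time, built on [\<partial>_j, x_i] =
  \<delta>_ij.\<close>

lemma diffop_weyl_x:
  fixes q :: "('n::finite, 'k::field_char_0) poly_ring"
  shows "diffop q * weyl_x i = weyl_x i * diffop q + diffop (pderiv_var i q)"
proof (induction q rule: poly_ring_induct)
  case (single m c)
  show ?case
  proof (induction m arbitrary: c rule: mindex_induct)
    case zero
    show ?case
      by (rule act_faithful)
        (simp add: act_add act_mult act_x act_diffop_single pderiv_var_single mult.left_commute)
  next
    case (unit m j)
    let ?q = "Poly_Mapping.single m c"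
    have D: "weyl_d j * weyl_x i = weyl_x i * weyl_d j + diffop (pderiv_var i (var j) :: ('n, 'k) poly_ring)"
      using weyl_relations(3)[of j i] by (auto simp: pderiv_var_var algebra_simps)
    have "Poly_Mapping.single (m + unit_index j) c = ?q * var j"
      by (simp add: var_def mult_single)
    then show ?case
      by (simp add: diffop_mult diffop_var pderiv_var_mult diffop_add mult.assoc D
          distrib_left unit) (simp add: unit algebra_simps flip: mult.assoc)
  qed
next
  case (add p q)
  then show ?case by (simp add: diffop_add mderiv_add algebra_simps)
qed

section \<open>Degrees\<close>

text \<open>With a strict bound, 0 characterizes the zero polynomial, so truncated subtraction of
  orders ends exactly at vanishing.\<close>

definition deg_less :: "('n::finite, 'k::zero) poly_ring \<Rightarrow> nat \<Rightarrow> bool" where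
  "deg_less p N \<longleftrightarrow> (\<forall>m\<in>Poly_Mapping.keys p. mdeg m < N)"

definition homogeneous :: "nat \<Rightarrow> ('n::finite, 'k::zero) poly_ring \<Rightarrow> bool" where
  "homogeneous k p \<longleftrightarrow> (\<forall>m\<in>Poly_Mapping.keys p. mdeg m = k)"

lemma mdeg_unit_index [simp]: "mdeg (unit_index i) = 1"
  by (simp add: mdeg_def lookup_single when_def)

lemma mdeg_0 [simp]: "mdeg 0 = 0"
  by (simp add: mdeg_def)

lemma deg_less_0 [simp]: "deg_less p 0 \<longleftrightarrow> p = 0"
  by (auto simp: deg_less_def)

lemma deg_less_zero [simp]: "deg_less 0 N"
  by (simp add: deg_less_def)

lemma deg_less_exists: "\<exists>N. deg_less p N"
  unfolding deg_less_def
  by (rule exI[of _ "Suc (Max (mdeg ` Poly_Mapping.keys p))"]) (simp add: less_Suc_eq_le)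

lemma deg_less_mono: "deg_less p M \<Longrightarrow> M \<le> N \<Longrightarrow> deg_less p N"
  by (auto simp: deg_less_def)

lemma deg_less_add: "deg_less p N \<Longrightarrow> deg_less q N \<Longrightarrow> deg_less (p + q) N"
  using keys_add[of p q] by (auto simp: deg_less_def)

lemma deg_less_sum: "(\<And>x. x \<in> S \<Longrightarrow> deg_less (f x) N) \<Longrightarrow> deg_less (sum f S) N"
  by (induction S rule: infinite_finite_induct) (auto intro: deg_less_add)

lemma deg_less_pconst_mult: "deg_less p N \<Longrightarrow> deg_less (pconst c * (p :: ('n::finite, 'k::ring_1) poly_ring)) N"
  by (fastforce simp: deg_less_def in_keys_iff lookup_pconst_mult)

lemma deg_less_var_mult:
  assumes "deg_less p N" shows "deg_less (var i * (p :: ('n::finite, 'k::ring_1) poly_ring)) (Suc N)"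
  using keys_mult[of "var i" p] assms
  by (fastforce simp: deg_less_def var_def mdeg_add)

lemma deg_less_mderiv: "deg_less p N \<Longrightarrow> deg_less (mderiv k p) (N - mdeg k)"
  by (force simp: deg_less_def in_keys_iff mderiv.rep_eq mdeg_add dest!: bspec)

lemma deg_less_diffop:
  assumes "homogeneous k q" "deg_less p N"
  shows "deg_less (diffop q \<rhd> p) (N - k)"
  unfolding act_diffop
proof (rule deg_less_sum)
  fix d
  show "deg_less (pconst (lookup q d) * mderiv d p) (N - k)"
    using assms deg_less_mderiv[of p N d]
    by (cases "lookup q d = 0")
      (auto intro!: deg_less_pconst_mult simp: homogeneous_def in_keys_iff)
qed

lemma homogeneous_0 [simp]: "homogeneous k 0"
  by (simp add: homogeneous_def)

lemma homogeneous_1 [simp]: "homogeneous 0 (1 :: ('n::finite, 'k::zero_neq_one) poly_ring)"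
  by (simp add: homogeneous_def flip: single_one)

lemma homogeneous_add: "homogeneous k p \<Longrightarrow> homogeneous k q \<Longrightarrow> homogeneous k (p + q)"
  using keys_add[of p q] by (auto simp: homogeneous_def)

lemma homogeneous_sum: "(\<And>x. x \<in> S \<Longrightarrow> homogeneous k (f x)) \<Longrightarrow> homogeneous k (sum f S)"
  by (induction S rule: infinite_finite_induct) (auto intro: homogeneous_add)

lemma homogeneous_mult:
  "homogeneous k p \<Longrightarrow> homogeneous l q \<Longrightarrow> homogeneous (k + l) (p * (q :: ('n::finite, 'k::ring_1) poly_ring))"
  using keys_mult[of p q] by (fastforce simp: homogeneous_def mdeg_add)

lemma poly_ring_sum_single:
  fixes p :: "('n, 'k::ab_group_add) poly_ring"
  shows "p = (\<Sum>m\<in>Poly_Mapping.keys p. Poly_Mapping.single m (lookup p m))"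
proof (intro poly_mapping_eqI)
  fix d
  show "lookup p d = lookup (\<Sum>m\<in>Poly_Mapping.keys p. Poly_Mapping.single m (lookup p m)) d"
    by (simp add: lookup_sum lookup_single when_def in_keys_iff)
qed

section \<open>The generating functions\<close>

lemma psi_fps_nth_0: "fps_nth psi_fps 0 = (1 :: 'k::field_char_0)"
  using arg_cong[OF psi_fps_eq, of "\<lambda>F. fps_nth F 1"]
  by (simp add: fps_mult_nth)

lemma psi_tilde_fps_nth_0: "fps_nth psi_tilde_fps 0 = (1 :: 'k::field_char_0)"
  using arg_cong[OF psi_tilde_fps_eq, of "\<lambda>F. fps_nth F 1"]
  by (simp add: fps_mult_nth)


text \<open>The defining equations with c t substituted for t; the first is also multiplied by
  e^(ct), so that both contain the factor e^(ct) - 1.\<close>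

lemma fps_dilated_psi:
  "fps_compose psi_fps (fps_const c * fps_X) * (fps_exp c - 1) =
     (fps_const c * fps_X * fps_exp c :: 'k::field_char_0 fps)"
  "fps_compose psi_tilde_fps (fps_const c * fps_X) * (fps_exp c - 1) =
     (fps_const c * fps_X :: 'k::field_char_0 fps)"
proof -
  have X: "fps_nth (fps_const c * fps_X :: 'k fps) 0 = 0" by simp
  have E: "fps_exp (- c) * fps_exp c = (1 :: 'k fps)"
    by (simp flip: fps_exp_add_mult)
  have "fps_compose psi_fps (fps_const c * fps_X) * (1 - fps_exp (- c)) = fps_const c * fps_X"
    using arg_cong[OF psi_fps_eq, of "\<lambda>F. fps_compose F (fps_const c * fps_X)"] X
    by (simp add: fps_compose_mult_distrib fps_compose_sub_distrib)
  then have "fps_compose psi_fps (fps_const c * fps_X) * ((1 - fps_exp (- c)) * fps_exp c) =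
      fps_const c * fps_X * fps_exp c"
    by (simp flip: mult.assoc)
  then show "fps_compose psi_fps (fps_const c * fps_X) * (fps_exp c - 1) = fps_const c * fps_X * fps_exp c"
    by (simp add: left_diff_distrib E)
  show "fps_compose psi_tilde_fps (fps_const c * fps_X) * (fps_exp c - 1) = fps_const c * fps_X"
    using arg_cong[OF psi_tilde_fps_eq, of "\<lambda>F. fps_compose F (fps_const c * fps_X)"] X
    by (simp add: fps_compose_mult_distrib fps_compose_sub_distrib)
qed

lemma fps_exp_neq_1: "c \<noteq> 0 \<Longrightarrow> fps_exp c - 1 \<noteq> (0 :: 'k::field_char_0 fps)"
  by (auto simp: fps_eq_iff intro!: exI[of _ 1])

text \<open>The functional equation behind the commutation, at b = 1 and multiplied by a; the formal
  variable records the total degree. With e(c) = e^(ct) - 1, clearing the denominators e(a), e(1),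
  e(a + 1) reduces it to e(a + 1) = e(a) e(1) + e(a) + e(1). The excluded a are those with a
  vanishing denominator.\<close>

lemma psi_fps_addition:
  fixes a :: "'k::field_char_0"
  assumes a: "a \<noteq> 0" "a \<noteq> - 1"
  defines "P c \<equiv> fps_compose psi_fps (fps_const c * fps_X)"
    and "Q c \<equiv> fps_compose psi_tilde_fps (fps_const c * fps_X)"
  shows "fps_const a * ((P (a + 1) - P a) * Q 1) + P a * (Q (a + 1) - Q 1) = 0"
proof -
  define e where "e c = fps_exp c - (1 :: 'k fps)" for c
  have nz: "e a \<noteq> 0" "e 1 \<noteq> 0" "e (a + 1) \<noteq> 0"
    unfolding e_def using a fps_exp_neq_1 by (auto simp: add_eq_0_iff2)
  have P: "P c * e c = fps_const c * fps_X * (e c + 1)" for c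
    unfolding P_def e_def by (simp add: fps_dilated_psi)
  have Q: "Q c * e c = fps_const c * fps_X" for c
    unfolding Q_def e_def by (simp add: fps_dilated_psi)
  have e: "e (a + 1) = e a * e 1 + e a + e 1"
    by (simp add: e_def fps_exp_add_mult algebra_simps)
  have c: "fps_const (a + 1) = fps_const a + 1" by (simp flip: fps_const_add)
  have "(fps_const a * ((P (a + 1) - P a) * Q 1) + P a * (Q (a + 1) - Q 1)) * (e a * e 1 * e (a + 1)) =
    fps_const a * (P (a + 1) * e (a + 1) * e a - P a * e a * e (a + 1)) * (Q 1 * e 1)
      + P a * e a * (Q (a + 1) * e (a + 1) * e 1 - Q 1 * e 1 * e (a + 1))"
    by (simp add: algebra_simps)
  also have "\<dots> = 0"
    unfolding P Q c unfolding e by (simp add: algebra_simps)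
  finally show ?thesis using nz by simp
qed

text \<open>The homogeneous part of degree \<open>n - 1\<close> of
  \<open>(\<psi>(a + b) - \<psi>(a)) \<psi>'(b) / b + (\<psi>'(a + b) - \<psi>'(b)) \<psi>(a) / a\<close>, dehomogenized by \<open>b = 1\<close>.\<close>

definition psi_poly :: "nat \<Rightarrow> 'k::field_char_0 poly" where
  "psi_poly n = (\<Sum>k\<le>n. smult (fps_nth psi_fps k * fps_nth psi_tilde_fps (n - k))
     ((\<Sum>i<k. [:0, 1:] ^ i * [:1, 1:] ^ (k - 1 - i)) +
      (\<Sum>i<n - k. [:0, 1:] ^ k * [:1, 1:] ^ (n - k - 1 - i))))"

text \<open>A nonzero polynomial has finitely many roots, but every a other than 0 and -1 is one: a
  times the value there is the n-th coefficient of the series in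
  \<open>psi_fps_addition\<close>.\<close>

lemma psi_poly_eq_0: "psi_poly n = (0 :: 'k::field_char_0 poly)"
proof (rule ccontr)
  assume "psi_poly n \<noteq> (0 :: 'k poly)"
  then have "finite {a. poly (psi_poly n) a = (0::'k)}"
    by (rule poly_roots_finite)
  moreover have "- {0, - 1} \<subseteq> {a. poly (psi_poly n) a = (0::'k)}"
  proof
    fix a :: 'k assume "a \<in> - {0, - 1}"
    then have a: "a \<noteq> 0" "a \<noteq> - 1" by auto
    \<comment> \<open>Geometric sums stand for the quotients by b = 1 and by a.\<close>
    have s1: "(\<Sum>i<k. a ^ i * (1 + a) ^ (k - 1 - i)) = (1 + a) ^ k - a ^ k" for k
      using power_diff_sumr2[of a k "1 + a"] by (simp add: algebra_simps)
    have s2: "a * (\<Sum>i<m. (1 + a) ^ (m - 1 - i)) = (1 + a) ^ m - 1" for m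
      using arg_cong[OF power_diff_sumr2[of 1 m "1 + a"], of uminus] by simp
    have "a * poly (psi_poly n) a = (\<Sum>k\<le>n. fps_nth psi_fps k * fps_nth psi_tilde_fps (n - k) *
        (a * (\<Sum>i<k. a ^ i * (1 + a) ^ (k - 1 - i)) +
         a ^ k * (a * (\<Sum>i<n - k. (1 + a) ^ (n - k - 1 - i)))))"
      by (simp add: psi_poly_def poly_sum sum_distrib_left algebra_simps)
    also have "\<dots> = (\<Sum>k\<le>n. fps_nth psi_fps k * fps_nth psi_tilde_fps (n - k) *
        (a * ((1 + a) ^ k - a ^ k) + a ^ k * ((1 + a) ^ (n - k) - 1)))"
      by (simp only: s1 s2)
    also have "\<dots> = fps_nth (fps_const a *
        ((fps_compose psi_fps (fps_const (a + 1) * fps_X) - fps_compose psi_fps (fps_const a * fps_X))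
          * fps_compose psi_tilde_fps (fps_const 1 * fps_X))
        + fps_compose psi_fps (fps_const a * fps_X) *
          (fps_compose psi_tilde_fps (fps_const (a + 1) * fps_X)
            - fps_compose psi_tilde_fps (fps_const 1 * fps_X))) n"
      unfolding fps_add_nth fps_mult_left_const_nth
      unfolding fps_mult_nth fps_sub_nth fps_nth_compose_linear atLeast0AtMost sum_distrib_left
        sum.distrib[symmetric]
      by (rule sum.cong) (simp_all add: algebra_simps)
    also have "\<dots> = 0"
      by (simp only: psi_fps_addition[OF a] fps_zero_nth)
    finally show "a \<in> {a. poly (psi_poly n) a = 0}" using a by simp
  qed
  ultimately have "finite (- {0, - 1 :: 'k})" by (rule rev_finite_subset)
  then show False by (simp add: infinite_UNIV_char_0)
qed

section \<open>Vector fields with polynomial coefficients in the derivatives\<close>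

definition vfield :: "('n::finite, 'k::field_char_0) poly_ring^'n \<Rightarrow> ('n, 'k) weyl" where
  "vfield P = (\<Sum>\<alpha>\<in>UNIV. weyl_x \<alpha> * diffop (P $ \<alpha>))"

text \<open>The derivative of \<open>P\<close> in direction \<open>Q\<close>, i.e. \<open>Q\<close>
  contracted with the Jacobian of \<open>P\<close>, the variables being the
  \<partial>_\<beta>.\<close>

definition dderiv :: "('n::finite, 'k::field_char_0) poly_ring^'n \<Rightarrow> ('n, 'k) poly_ring^'n \<Rightarrow> ('n, 'k) poly_ring^'n" where
  "dderiv Q P = (\<chi> \<alpha>. \<Sum>\<beta>\<in>UNIV. Q $ \<beta> * pderiv_var \<beta> (P $ \<alpha>))"

lemma vfield_add: "vfield (P + Q) = vfield P + vfield Q"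
  by (simp add: vfield_def diffop_add distrib_left sum.distrib)

lemma vfield_diff: "vfield (P - Q) = vfield P - vfield Q"
  by (simp add: vfield_def diffop_diff right_diff_distrib sum_subtractf)

lemma vfield_0 [simp]: "vfield 0 = 0"
  by (simp add: vfield_def)

lemma vfield_sum: "vfield (sum f S) = (\<Sum>x\<in>S. vfield (f x))"
  by (induction S rule: infinite_finite_induct) (simp_all add: vfield_add)

lemma act_vfield: "vfield P \<rhd> p = (\<Sum>\<alpha>\<in>UNIV. var \<alpha> * (diffop (P $ \<alpha>) \<rhd> p))"
  by (simp add: vfield_def act_sum act_mult act_x)

lemma act_vfield_scale: "vfield (pconst c *s P) \<rhd> p = pconst c * (vfield P \<rhd> p)"
  by (simp add: act_vfield diffop_pconst_mult act_weyl_scale sum_distrib_left mult.left_commute)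

text \<open>Normal ordering: moving the operator of the left factor past x_\<beta> leaves a part
  quadratic in x and, by \<open>diffop_weyl_x\<close>, a correction linear in x.\<close>

lemma vfield_mult:
  "vfield P * vfield Q =
    (\<Sum>\<alpha>\<in>UNIV. \<Sum>\<beta>\<in>UNIV. weyl_x \<alpha> * weyl_x \<beta> * diffop (P $ \<alpha> * Q $ \<beta>)) + vfield (dderiv Q P)"
proof -
  have "vfield P * vfield Q =
      (\<Sum>\<alpha>\<in>UNIV. \<Sum>\<beta>\<in>UNIV. weyl_x \<alpha> * (diffop (P $ \<alpha>) * weyl_x \<beta>) * diffop (Q $ \<beta>))"
    by (simp add: vfield_def sum_product mult.assoc)
  also have "\<dots> = (\<Sum>\<alpha>\<in>UNIV. \<Sum>\<beta>\<in>UNIV. weyl_x \<alpha> * weyl_x \<beta> * diffop (P $ \<alpha> * Q $ \<beta>)) +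
      (\<Sum>\<alpha>\<in>UNIV. \<Sum>\<beta>\<in>UNIV. weyl_x \<alpha> * diffop (Q $ \<beta> * pderiv_var \<beta> (P $ \<alpha>)))"
    unfolding diffop_weyl_x sum.distrib[symmetric]
    by (intro sum.cong refl) (simp add: diffop_mult algebra_simps diffop_commute)
  also have "(\<Sum>\<alpha>\<in>UNIV. \<Sum>\<beta>\<in>UNIV. weyl_x \<alpha> * diffop (Q $ \<beta> * pderiv_var \<beta> (P $ \<alpha>))) = vfield (dderiv Q P)"
    by (simp add: vfield_def dderiv_def diffop_sum sum_distrib_left)
  finally show ?thesis .
qed

text \<open>The quadratic parts agree after exchanging \<alpha> and \<beta>, so only the linear
  corrections survive: up to sign, the Lie bracket of vector fields in the \<partial>
  variables.\<close>

lemma vfield_commutator: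
  "vfield P * vfield Q - vfield Q * vfield P = vfield (dderiv Q P - dderiv P Q)"
proof -
  have "(\<Sum>\<alpha>\<in>UNIV. \<Sum>\<beta>\<in>UNIV. weyl_x \<alpha> * weyl_x \<beta> * diffop (P $ \<alpha> * Q $ \<beta>)) =
      (\<Sum>\<alpha>\<in>UNIV. \<Sum>\<beta>\<in>UNIV. weyl_x \<alpha> * weyl_x \<beta> * diffop (Q $ \<alpha> * P $ \<beta>))"
    by (subst sum.swap) (simp add: mult.commute weyl_x_commute)
  then show ?thesis by (simp add: vfield_mult vfield_diff)
qed

section \<open>Matrices of linear forms\<close>

lemma row_matrix_mult: "(A ** B) $ i = A $ i v* (B :: 'a::comm_semiring_1^'n^'m::finite)"
  by (simp add: matrix_matrix_mult_def vector_matrix_mult_def vec_eq_iff mult.commute)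

lemma matpow_commute: "matpow A k ** A = A ** matpow A k"
  by (induction k) (simp_all add: matrix_mul_assoc[symmetric])

lemma matrix_sum_right: "A ** sum f S = (\<Sum>x\<in>S. A ** (f x :: 'a::comm_ring_1^'n::finite^'n))"
  by (induction S rule: infinite_finite_induct) (simp_all add: matrix_add_ldistrib)

lemma sum_vector_matrix_mult: "sum f S v* A = (\<Sum>x\<in>S. f x v* (A :: 'a::comm_ring_1^'n::finite^'m::finite))"
  by (simp add: vector_matrix_mult_def vec_eq_iff sum_distrib_right) (intro allI sum.swap)

lemma smult_vector_matrix_mult: "(c *s v) v* A = c *s (v v* (A :: 'a::comm_ring_1^'n::finite^'m::finite))"
  by (simp add: vector_matrix_mult_def vec_eq_iff sum_distrib_left algebra_simps)

lemma add_vector_matrix_mult: "(v + w) v* A = v v* A + w v* (A :: 'a::comm_ring_1^'n::finite^'m::finite)"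
  by (simp add: vector_matrix_mult_def vec_eq_iff sum.distrib algebra_simps)

lemma smult_sum_vec: "c *s sum f S = (\<Sum>x\<in>S. c *s (f x :: 'a::comm_ring_1^'n))"
  by (simp add: vec_eq_iff sum_distrib_left)

text \<open>The second axiom reads [[e_i, e_j], e_k] = [[e_i, e_k], e_j] + [e_i, [e_j, e_k]]:
  bracketing with e_k on the right is a derivation.\<close>

locale structure_constants =
  fixes C :: "'n::finite \<Rightarrow> 'n \<Rightarrow> 'n \<Rightarrow> 'k::field_char_0"
  assumes antisym: "C j i k = - C i j k"
    and jacobi: "(\<Sum>e\<in>UNIV. C i j e * C e k l) =
      (\<Sum>e\<in>UNIV. C i k e * C e j l) + (\<Sum>e\<in>UNIV. C j k e * C i e l)"
begin

section \<open>The bracket of row vectors and the derivation C\<close>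

definition cmat :: "('n, 'k) poly_ring^'n^'n" where
  "cmat = (\<chi> i j. \<Sum>a\<in>UNIV. pconst (C i a j) * var a)"

text \<open>Applied to row vectors from the right, this is the map v \<mapsto> [v, e_b].\<close>

definition ad :: "'n \<Rightarrow> ('n, 'k) poly_ring^'n^'n" where
  "ad b = (\<chi> i j. pconst (C i b j))"

definition vbracket :: "('n, 'k) poly_ring^'n \<Rightarrow> ('n, 'k) poly_ring^'n \<Rightarrow> ('n, 'k) poly_ring^'n" where
  "vbracket v w = (\<Sum>b\<in>UNIV. w $ b *s (v v* ad b))"

lemma vbracket_nth: "vbracket v w $ c = (\<Sum>a\<in>UNIV. \<Sum>b\<in>UNIV. v $ a * w $ b * pconst (C a b c))"
proof -
  have "vbracket v w $ c = (\<Sum>b\<in>UNIV. \<Sum>a\<in>UNIV. v $ a * w $ b * pconst (C a b c))"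
    by (simp add: vbracket_def ad_def vector_matrix_mult_def sum_distrib_left algebra_simps)
  then show ?thesis by (simp add: sum.swap[of "\<lambda>b a. v $ a * w $ b * pconst (C a b c)"])
qed

lemma vbracket_antisym: "vbracket w v = - vbracket v w"
proof -
  have "vbracket w v $ c = - vbracket v w $ c" for c
    unfolding vbracket_nth sum_negf[symmetric]
    by (subst sum.swap) (intro sum.cong refl,
        subst antisym, simp add: single_uminus algebra_simps)
  then show ?thesis by (simp add: vec_eq_iff)
qed

lemma struct_matrix_nth: "struct_matrix C $ i $ j = diffop (cmat $ i $ j)"
  by (simp add: struct_matrix_def cmat_def diffop_sum diffop_pconst_mult diffop_var)

lemma matpow_struct_matrix_nth: "matpow (struct_matrix C) k $ i $ j = diffop (matpow cmat k $ i $ j)"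
  by (induction k arbitrary: i)
    (simp_all add: mat_def matrix_matrix_mult_def struct_matrix_nth diffop_sum diffop_mult)

lemma homogeneous_cmat: "homogeneous 1 (cmat $ i $ j)"
proof -
  have "homogeneous 1 (pconst (C i a j) * var a)" for a
    by (simp add: var_def mult_single homogeneous_def)
  then show ?thesis by (simp add: cmat_def homogeneous_sum)
qed

lemma homogeneous_matpow: "homogeneous k (matpow cmat k $ i $ j)"
proof (induction k arbitrary: i)
  case 0
  show ?case by (simp add: mat_def)
next
  case (Suc k)
  show ?case
    using homogeneous_mult[OF homogeneous_cmat Suc]
    by (auto simp: matrix_matrix_mult_def intro!: homogeneous_sum)
qed

definition mderiv_mat :: "'n \<Rightarrow> ('n, 'k) poly_ring^'n^'n \<Rightarrow> ('n, 'k) poly_ring^'n^'n" where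
  "mderiv_mat b A = (\<chi> i j. pderiv_var b (A $ i $ j))"

lemma mderiv_mat_mult: "mderiv_mat b (A ** B) = mderiv_mat b A ** B + A ** mderiv_mat b B"
  by (simp add: mderiv_mat_def matrix_matrix_mult_def vec_eq_iff mderiv_sum pderiv_var_mult sum.distrib)

lemma mderiv_mat_cmat: "mderiv_mat b cmat = ad b"
proof -
  have "pderiv_var b (\<Sum>a\<in>UNIV. pconst (C i a j) * var a) = pconst (C i b j)" for i j
    by (simp add: mderiv_sum mderiv_pconst_mult pderiv_var_var if_distrib cong: if_cong)
  then show ?thesis by (simp add: mderiv_mat_def cmat_def ad_def vec_eq_iff)
qed

text \<open>The product rule with the order of factors kept, since \<open>ad b\<close> need not
  commute with \<open>cmat\<close>: summand l differentiates the factor that follows the first l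
  ones.\<close>

lemma mderiv_mat_matpow:
  "mderiv_mat b (matpow cmat k) = (\<Sum>l<k. matpow cmat l ** (ad b ** matpow cmat (k - 1 - l)))"
proof (induction k)
  case 0
  have "pderiv_var b 1 = (0 :: ('n, 'k) poly_ring)"
    by (metis mult_1_right pconst_mult pderiv_var_single single_one single_zero lookup_zero of_nat_0 mult_zero_left)
  then show ?case by (auto simp: mderiv_mat_def mat_def vec_eq_iff)
next
  case (Suc k)
  show ?case
    unfolding sum.lessThan_Suc_shift
    by (simp add: mderiv_mat_mult mderiv_mat_cmat Suc matrix_sum_right matrix_mul_assoc)
qed

text \<open>\<open>cmat\<close> brackets with the vector whose k-th entry is \<partial>_k, so this
  is \<open>jacobi\<close> multiplied by \<open>V i j k\<close> and summed.\<close>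

lemma vbracket_cmat: "vbracket v w v* cmat = vbracket (v v* cmat) w + vbracket v (w v* cmat)"
proof -
  have "(vbracket v w v* cmat) $ l = (vbracket (v v* cmat) w + vbracket v (w v* cmat)) $ l" for l
  proof -
    define V where "V i j k = v $ i * w $ j * var k" for i j k
    have cj: "pconst (\<Sum>e\<in>UNIV. C i j e * C e k l) =
        (\<Sum>e\<in>UNIV. pconst (C i j e) * pconst (C e k l) :: ('n, 'k) poly_ring)"
      "pconst (\<Sum>e\<in>UNIV. C i j e * C k e l) =
        (\<Sum>e\<in>UNIV. pconst (C i j e) * pconst (C k e l) :: ('n, 'k) poly_ring)"
      for i j k
      by (simp_all add: pconst_sum pconst_mult)
    have "(vbracket v w v* cmat) $ l = (\<Sum>e\<in>UNIV. \<Sum>i\<in>UNIV. \<Sum>j\<in>UNIV. \<Sum>k\<in>UNIV.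
        V i j k * (pconst (C i j e) * pconst (C e k l)))"
      by (simp add: vector_matrix_mult_def vbracket_nth cmat_def V_def sum_distrib_left sum_distrib_right algebra_simps)
    \<comment> \<open>The index e of the inner bracket moves innermost, so that
      \<open>jacobi\<close> applies for each i, j, k.\<close>
    also have "\<dots> = (\<Sum>i\<in>UNIV. \<Sum>j\<in>UNIV. \<Sum>k\<in>UNIV. \<Sum>e\<in>UNIV.
        V i j k * (pconst (C i j e) * pconst (C e k l)))"
      by (subst sum.swap, rule sum.cong[OF refl], subst sum.swap, rule sum.cong[OF refl], rule sum.swap)
    also have "\<dots> = (\<Sum>i\<in>UNIV. \<Sum>j\<in>UNIV. \<Sum>k\<in>UNIV.
        V i j k * pconst (\<Sum>e\<in>UNIV. C i j e * C e k l))"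
      by (simp add: cj sum_distrib_left)
    also have "\<dots> = (\<Sum>i\<in>UNIV. \<Sum>j\<in>UNIV. \<Sum>k\<in>UNIV.
        V i j k * pconst (\<Sum>e\<in>UNIV. C i k e * C e j l))
      + (\<Sum>i\<in>UNIV. \<Sum>j\<in>UNIV. \<Sum>k\<in>UNIV. V i j k * pconst (\<Sum>e\<in>UNIV. C j k e * C i e l))"
      by (subst jacobi) (simp add: single_add distrib_left sum.distrib)
    also have "(\<Sum>i\<in>UNIV. \<Sum>j\<in>UNIV. \<Sum>k\<in>UNIV. V i j k * pconst (\<Sum>e\<in>UNIV. C i k e * C e j l)) =
       (\<Sum>i\<in>UNIV. \<Sum>j\<in>UNIV. \<Sum>e\<in>UNIV. \<Sum>k\<in>UNIV. V i j k * (pconst (C i k e) * pconst (C e j l)))"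
      unfolding cj sum_distrib_left by (intro sum.cong refl sum.swap)
    \<comment> \<open>Here e takes the place of i as the left index of the outer bracket, numbering
      the entries of \<open>v v* cmat\<close>.\<close>
    also have "\<dots> = (\<Sum>e\<in>UNIV. \<Sum>j\<in>UNIV. \<Sum>i\<in>UNIV. \<Sum>k\<in>UNIV. V i j k * (pconst (C i k e) * pconst (C e j l)))"
      by (subst (2) sum.swap, subst sum.swap, rule sum.cong[OF refl], rule sum.swap)
    also have "\<dots> = vbracket (v v* cmat) w $ l"
      by (simp add: vector_matrix_mult_def vbracket_nth cmat_def V_def sum_distrib_left sum_distrib_right algebra_simps)
    also have "(\<Sum>i\<in>UNIV. \<Sum>j\<in>UNIV. \<Sum>k\<in>UNIV. V i j k * pconst (\<Sum>e\<in>UNIV. C j k e * C i e l)) =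
       (\<Sum>i\<in>UNIV. \<Sum>j\<in>UNIV. \<Sum>e\<in>UNIV. \<Sum>k\<in>UNIV. V i j k * (pconst (C j k e) * pconst (C i e l)))"
      unfolding cj sum_distrib_left by (intro sum.cong refl sum.swap)
    also have "\<dots> = (\<Sum>i\<in>UNIV. \<Sum>e\<in>UNIV. \<Sum>j\<in>UNIV. \<Sum>k\<in>UNIV. V i j k * (pconst (C j k e) * pconst (C i e l)))"
      by (intro sum.cong refl sum.swap)
    also have "\<dots> = vbracket v (w v* cmat) $ l"
      by (simp add: vector_matrix_mult_def vbracket_nth cmat_def V_def sum_distrib_left sum_distrib_right algebra_simps)
    finally show ?thesis by simp
  qed
  then show ?thesis by (simp add: vec_eq_iff)
qed

text \<open>Contracting with w over the direction b turns each inserted \<open>ad b\<close> into a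
  bracket with w.\<close>

lemma dderiv_matpow:
  "dderiv w (matpow cmat k $ \<mu>) = (\<Sum>l<k. vbracket (matpow cmat l $ \<mu>) w v* matpow cmat (k - 1 - l))"
proof -
  have "dderiv w (matpow cmat k $ \<mu>) = (\<Sum>b\<in>UNIV. w $ b *s (mderiv_mat b (matpow cmat k) $ \<mu>))"
    by (simp add: dderiv_def mderiv_mat_def vec_eq_iff)
  also have "\<dots> = (\<Sum>b\<in>UNIV. \<Sum>l<k. (w $ b *s (matpow cmat l $ \<mu> v* ad b)) v* matpow cmat (k - 1 - l))"
    unfolding mderiv_mat_matpow
    by (simp add: row_matrix_mult vector_matrix_mul_assoc smult_sum_vec smult_vector_matrix_mult)
  also have "\<dots> = (\<Sum>l<k. vbracket (matpow cmat l $ \<mu>) w v* matpow cmat (k - 1 - l))"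
    unfolding vbracket_def sum_vector_matrix_mult by (rule sum.swap)
  finally show ?thesis .
qed

section \<open>Polynomials in the left and right actions of C\<close>

text \<open>Evaluates a polynomial in \<open>a\<close>, homogenized to degree \<open>d\<close> with \<open>b\<close>, at \<open>[e\<^sub>\<mu>, e\<^sub>\<nu>]\<close>.\<close>

definition pairing :: "'n \<Rightarrow> 'n \<Rightarrow> nat \<Rightarrow> 'k poly \<Rightarrow> ('n, 'k) poly_ring^'n" where
  "pairing \<mu> \<nu> d q = (\<Sum>p\<le>d. pconst (coeff q p) *s vbracket (matpow cmat p $ \<mu>) (matpow cmat (d - p) $ \<nu>))"

lemma pairing_add: "pairing \<mu> \<nu> d (q + r) = pairing \<mu> \<nu> d q + pairing \<mu> \<nu> d r"
  by (simp add: pairing_def single_add vec_eq_iff distrib_right sum.distrib)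

lemma pairing_0 [simp]: "pairing \<mu> \<nu> d 0 = 0"
  by (simp add: pairing_def vec_eq_iff)

lemma pairing_sum: "pairing \<mu> \<nu> d (sum f S) = (\<Sum>x\<in>S. pairing \<mu> \<nu> d (f x))"
  by (induction S rule: infinite_finite_induct) (simp_all add: pairing_add)

lemma pairing_smult: "pairing \<mu> \<nu> d (smult c q) = pconst c *s pairing \<mu> \<nu> d q"
  by (simp add: pairing_def pconst_mult vec_eq_iff sum_distrib_left mult.assoc)

text \<open>At b = 1 the polynomial \<open>[:1, 1:]\<close> is a + b, which acts on a bracket as
  \<open>cmat\<close>; m is the power of b supplied by homogenization. The induction splits one
  factor a + b into a and b.\<close>

lemma pairing_power:
  "pairing \<mu> \<nu> (i + j + m) ([:0, 1:] ^ i * [:1, 1:] ^ j) =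
     vbracket (matpow cmat i $ \<mu>) (matpow cmat m $ \<nu>) v* matpow cmat j"
proof (induction j arbitrary: i m)
  case 0
  have "pairing \<mu> \<nu> (i + m) ([:0, 1:] ^ i) =
      (\<Sum>p\<le>i + m. if p = i then vbracket (matpow cmat i $ \<mu>) (matpow cmat m $ \<nu>) else 0)"
    unfolding pairing_def
    by (intro sum.cong refl) (auto simp: vec_eq_iff simp flip: monom_altdef[of 1, simplified])
  then show ?case by simp
next
  case (Suc j)
  have "[:0, 1:] ^ i * [:1, 1:] ^ Suc j = [:0, 1:] ^ Suc i * [:1, 1:] ^ j + [:0, 1:] ^ i * ([:1, 1:] ^ j :: 'k poly)"
    by (simp add: algebra_simps)
  then have "pairing \<mu> \<nu> (i + Suc j + m) ([:0, 1:] ^ i * [:1, 1:] ^ Suc j) =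
      (vbracket (matpow cmat (Suc i) $ \<mu>) (matpow cmat m $ \<nu>) +
         vbracket (matpow cmat i $ \<mu>) (matpow cmat (Suc m) $ \<nu>))
        v* matpow cmat j"
    using Suc[of "Suc i" m] Suc[of i "Suc m"]
    by (simp add: pairing_add add_vector_matrix_mult del: power_Suc matpow.simps)
  also have "\<dots> = vbracket (matpow cmat i $ \<mu>) (matpow cmat m $ \<nu>) v* cmat v* matpow cmat j"
    by (simp add: vbracket_cmat row_matrix_mult[symmetric] matpow_commute)
  finally show ?case by (simp add: vector_matrix_mul_assoc)
qed

text \<open>Each derivative of a power is a \<open>pairing\<close> with a geometric sum, of degree n
  - 1 because one factor is differentiated away. The weighted sum pairs with
  \<open>psi_poly n\<close>.\<close>

lemma sum_commutator_eq_0: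
  "(\<Sum>k\<le>n. pconst (fps_nth psi_fps k * fps_nth psi_tilde_fps (n - k)) *s
     (dderiv (matpow cmat (n - k) $ \<nu>) (matpow cmat k $ \<mu>)
      - dderiv (matpow cmat k $ \<mu>) (matpow cmat (n - k) $ \<nu>))) = 0"
proof -
  have "dderiv (matpow cmat (n - k) $ \<nu>) (matpow cmat k $ \<mu>)
      - dderiv (matpow cmat k $ \<mu>) (matpow cmat (n - k) $ \<nu>) =
     pairing \<mu> \<nu> (n - 1) ((\<Sum>i<k. [:0, 1:] ^ i * [:1, 1:] ^ (k - 1 - i)) +
      (\<Sum>i<n - k. [:0, 1:] ^ k * [:1, 1:] ^ (n - k - 1 - i)))" if "k \<le> n" for k
  proof -
    have "pairing \<mu> \<nu> (n - 1) ([:0, 1:] ^ i * [:1, 1:] ^ (k - 1 - i)) =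
        vbracket (matpow cmat i $ \<mu>) (matpow cmat (n - k) $ \<nu>) v* matpow cmat (k - 1 - i)" if "i < k" for i
      using pairing_power[of \<mu> \<nu> i "k - 1 - i" "n - k"] that \<open>k \<le> n\<close> by simp
    \<comment> \<open>Antisymmetry puts the \<mu> argument first; its sign cancels that of the
      subtracted derivative.\<close>
    moreover have "pairing \<mu> \<nu> (n - 1) ([:0, 1:] ^ k * [:1, 1:] ^ (n - k - 1 - i)) =
        - (vbracket (matpow cmat i $ \<nu>) (matpow cmat k $ \<mu>) v* matpow cmat (n - k - 1 - i))" if "i < n - k" for i
    proof -
      have "(- v) v* A = - (v v* A)" for v and A :: "('n, 'k) poly_ring^'n^'n"
        by (simp add: vector_matrix_mult_def vec_eq_iff sum_negf)
      then show ?thesis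
        using pairing_power[of \<mu> \<nu> k "n - k - 1 - i" i] that
          vbracket_antisym[of "matpow cmat k $ \<mu>" "matpow cmat i $ \<nu>"] by simp
    qed
    ultimately show ?thesis
      by (simp add: pairing_add pairing_sum dderiv_matpow sum_negf)
  qed
  then have "(\<Sum>k\<le>n. pconst (fps_nth psi_fps k * fps_nth psi_tilde_fps (n - k)) *s
     (dderiv (matpow cmat (n - k) $ \<nu>) (matpow cmat k $ \<mu>)
      - dderiv (matpow cmat k $ \<mu>) (matpow cmat (n - k) $ \<nu>))) = pairing \<mu> \<nu> (n - 1) (psi_poly n)"
    by (simp add: psi_poly_def pairing_sum pairing_smult)
  then show ?thesis by (simp add: psi_poly_eq_0)
qed

section \<open>The realizations graded by the order in \<partial>\<close>

definition gen_part :: "nat \<Rightarrow> 'n \<Rightarrow> ('n, 'k) weyl" where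
  "gen_part k \<mu> = vfield (matpow cmat k $ \<mu>)"

lemma gen_part_0: "gen_part 0 \<mu> \<rhd> p = var \<mu> * p"
proof -
  have "var \<alpha> * (diffop (mat 1 $ \<mu> $ \<alpha>) \<rhd> p) = (if \<alpha> = \<mu> then var \<mu> * p else 0)" for \<alpha>
    by (auto simp: mat_def)
  then show ?thesis by (simp add: gen_part_def act_vfield)
qed

text \<open>Order k lowers the degree by k and the factor x_\<alpha> raises it by one. For k > N
  this count, \<open>Suc (N - k)\<close>, is one too large, but there the derivatives already kill
  p.\<close>

lemma deg_less_gen_part:
  assumes "deg_less p N" shows "deg_less (gen_part k \<mu> \<rhd> p) (N + 1 - k)"
proof (cases "k \<le> N")
  case True
  then show ?thesis
    unfolding gen_part_def act_vfield
    by (auto intro!: deg_less_sum deg_less_var_mult deg_less_diffop homogeneous_matpow assms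
        simp: Suc_diff_le)
next
  case False
  then have "diffop (matpow cmat k $ \<mu> $ \<alpha>) \<rhd> p = 0" for \<alpha>
    using deg_less_diffop[OF homogeneous_matpow assms, of k \<mu> \<alpha>] by simp
  then show ?thesis by (simp add: gen_part_def act_vfield)
qed

lemma gen_part_eq_0:
  assumes "deg_less p N" "N \<le> k" shows "gen_part k \<mu> \<rhd> p = 0"
proof -
  have "diffop (matpow cmat k $ \<mu> $ \<alpha>) \<rhd> p = 0" for \<alpha>
    using deg_less_diffop[OF homogeneous_matpow assms(1), of k \<mu> \<alpha>] assms(2) by simp
  then show ?thesis by (simp add: gen_part_def act_vfield)
qed

lemma sum_gen_part_commutator:
  "(\<Sum>k\<le>n. pconst (fps_nth psi_fps k * fps_nth psi_tilde_fps (n - k)) *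
     ((gen_part k \<mu> * gen_part (n - k) \<nu> - gen_part (n - k) \<nu> * gen_part k \<mu>) \<rhd> p)) = 0"
  unfolding gen_part_def vfield_commutator act_vfield_scale[symmetric]
  by (simp only: act_sum[symmetric] vfield_sum[symmetric] sum_commutator_eq_0 vfield_0 act_zero)

definition realization :: "'k fps \<Rightarrow> 'n \<Rightarrow> ('n, 'k) weyl" where
  "realization F \<mu> = (\<Sum>\<alpha>\<in>UNIV. weyl_x \<alpha> * fps_matrix F (struct_matrix C) $ \<mu> $ \<alpha>)"

text \<open>By homogeneity the coefficient at \<partial>^d comes only from k =
  \<open>mdeg d\<close>, and only d of degree below N meet p. Hence any truncation M \<ge> N is
  exact.\<close>

lemma act_fps_matrix:
  assumes "deg_less p N" "N \<le> M"
  shows "fps_matrix F (struct_matrix C) $ i $ j \<rhd> p =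
    (\<Sum>k<M. pconst (fps_nth F k) * (diffop (matpow cmat k $ i $ j) \<rhd> p))"
proof -
  have hom: "lookup (matpow cmat k $ i $ j) d = 0" if "mdeg d \<noteq> k" for k d
    using homogeneous_matpow[of k i j] that by (auto simp: homogeneous_def in_keys_iff)
  have coeff: "dcoeff (fps_matrix F (struct_matrix C) $ i $ j) d =
      (\<Sum>k<M. pconst (fps_nth F k) * pconst (lookup (matpow cmat k $ i $ j) d))"
    if "d \<in> dsupp p" for d
  proof -
    from that obtain m where "d + m \<in> Poly_Mapping.keys p" by (auto simp: dsupp_def)
    then have d: "mdeg d < M" using assms by (force simp: deg_less_def mdeg_add)
    have "dcoeff (fps_matrix F (struct_matrix C) $ i $ j) d =
        Sum_any (\<lambda>k. pconst (fps_nth F k) * pconst (lookup (matpow cmat k $ i $ j) d))"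
      by (simp add: fps_matrix_def Weyl_inverse weyl_scale.rep_eq matpow_struct_matrix_nth)
    also have "\<dots> = (\<Sum>k<M. pconst (fps_nth F k) * pconst (lookup (matpow cmat k $ i $ j) d))"
    proof (rule Sum_any.expand_superset)
      show "{k. pconst (fps_nth F k) * pconst (lookup (matpow cmat k $ i $ j) d) \<noteq> 0} \<subseteq> {..<M}"
        using d hom[of d] by (auto intro: ccontr)
    qed simp
    finally show ?thesis .
  qed
  have "fps_matrix F (struct_matrix C) $ i $ j \<rhd> p = (\<Sum>d\<in>dsupp p.
      (\<Sum>k<M. pconst (fps_nth F k) * pconst (lookup (matpow cmat k $ i $ j) d)) * mderiv d p)"
    by (simp add: act_eq_sum[OF finite_dsupp order.refl] coeff)
  also have "\<dots> = (\<Sum>k<M. pconst (fps_nth F k) * (diffop (matpow cmat k $ i $ j) \<rhd> p))"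
    unfolding act_diffop sum_distrib_left sum_distrib_right
    by (subst sum.swap) (simp add: mult.assoc)
  finally show ?thesis .
qed

lemma act_realization:
  assumes "deg_less p N" "N \<le> M"
  shows "realization F \<mu> \<rhd> p = (\<Sum>k<M. pconst (fps_nth F k) * (gen_part k \<mu> \<rhd> p))"
proof -
  have "realization F \<mu> \<rhd> p =
      (\<Sum>\<alpha>\<in>UNIV. \<Sum>k<M. var \<alpha> * (pconst (fps_nth F k) * (diffop (matpow cmat k $ \<mu> $ \<alpha>) \<rhd> p)))"
    by (simp add: realization_def act_sum act_mult act_x act_fps_matrix[OF assms] sum_distrib_left)
  also have "\<dots> = (\<Sum>k<M. pconst (fps_nth F k) * (gen_part k \<mu> \<rhd> p))"
    unfolding gen_part_def act_vfield sum_distrib_left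
    by (subst sum.swap) (simp add: mult.left_commute)
  finally show ?thesis .
qed

text \<open>A Cauchy product graded by n = k + m. The bound is \<open>Suc N\<close> because the
  inner realization can raise the degree by one.\<close>

lemma act_realization2:
  assumes "deg_less p N"
  shows "realization F \<mu> \<rhd> realization G \<nu> \<rhd> p =
    (\<Sum>n<Suc N. \<Sum>k\<le>n. pconst (fps_nth F k * fps_nth G (n - k)) * (gen_part k \<mu> \<rhd> gen_part (n - k) \<nu> \<rhd> p))"
proof -
  define t where "t k m = pconst (fps_nth F k * fps_nth G m) * (gen_part k \<mu> \<rhd> gen_part m \<nu> \<rhd> p)" for k m
  \<comment> \<open>The inner result has degree below N + 1 - m, so every k from that bound on kills
    it.\<close>
  have t0: "t k m = 0" if "k + m \<ge> Suc N" for k m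
    using gen_part_eq_0[OF deg_less_gen_part[OF assms, of m \<nu>], of k \<mu>] that by (simp add: t_def)
  have "realization F \<mu> \<rhd> (gen_part m \<nu> \<rhd> p) =
      (\<Sum>k<Suc N. pconst (fps_nth F k) * (gen_part k \<mu> \<rhd> gen_part m \<nu> \<rhd> p))" for m
    by (rule act_realization[OF deg_less_gen_part[OF assms]]) simp
  then have "realization F \<mu> \<rhd> realization G \<nu> \<rhd> p = (\<Sum>m<Suc N. \<Sum>k<Suc N. t k m)"
    by (simp add: act_realization[OF assms le_SucI[OF order.refl]] act_sum_right act_pconst_mult
        t_def pconst_mult sum_distrib_left ac_simps del: sum.lessThan_Suc)
  also have "\<dots> = (\<Sum>(k, m)\<in>{..<Suc N} \<times> {..<Suc N}. t k m)"
    by (subst sum.swap) (rule sum.cartesian_product)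
  also have "\<dots> = (\<Sum>(k, m)\<in>{(k, m). k + m < Suc N}. t k m)"
    by (rule sum.mono_neutral_right) (auto intro!: t0)
  also have "\<dots> = (\<Sum>n<Suc N. \<Sum>k\<le>n. t k (n - k))"
    by (rule sum.triangle_reindex)
  finally show ?thesis by (simp only: t_def)
qed

lemma sum_antidiagonal_swap: "(\<Sum>k\<le>n::nat. f k (n - k)) = (\<Sum>k\<le>n. f (n - k) k)"
  by (rule sum.reindex_bij_witness[where i = "\<lambda>k. n - k" and j = "\<lambda>k. n - k"]) auto

lemma realizations_commute:
  "realization psi_fps \<mu> * realization psi_tilde_fps \<nu> =
   realization psi_tilde_fps \<nu> * realization psi_fps \<mu>"
proof (rule act_faithful)
  fix p :: "('n, 'k) poly_ring"
  obtain N where N: "deg_less p N" using deg_less_exists by blast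
  have "(realization psi_tilde_fps \<nu> * realization psi_fps \<mu>) \<rhd> p =
    (\<Sum>n<Suc N. \<Sum>k\<le>n. pconst (fps_nth psi_tilde_fps k * fps_nth psi_fps (n - k)) *
        (gen_part k \<nu> \<rhd> gen_part (n - k) \<mu> \<rhd> p))"
    unfolding act_mult by (rule act_realization2[OF N])
  \<comment> \<open>Reversing k \<mapsto> n - k gives both products the same coefficients, so their
    difference is a sum of commutators for each n.\<close>
  also have "\<dots> = (\<Sum>n<Suc N. \<Sum>k\<le>n. pconst (fps_nth psi_fps k * fps_nth psi_tilde_fps (n - k)) *
        (gen_part (n - k) \<nu> \<rhd> gen_part k \<mu> \<rhd> p))"
    by (rule sum.cong[OF refl], subst sum_antidiagonal_swap) (simp only: mult.commute)
  finally have "(realization psi_fps \<mu> * realization psi_tilde_fps \<nu>) \<rhd> p -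
      (realization psi_tilde_fps \<nu> * realization psi_fps \<mu>) \<rhd> p =
    (\<Sum>n<Suc N. \<Sum>k\<le>n. pconst (fps_nth psi_fps k * fps_nth psi_tilde_fps (n - k)) *
     ((gen_part k \<mu> * gen_part (n - k) \<nu> - gen_part (n - k) \<nu> * gen_part k \<mu>) \<rhd> p))"
    unfolding act_mult act_realization2[OF N]
    by (simp only: sum_subtractf[symmetric] act_diff act_mult right_diff_distrib)
  also have "\<dots> = 0" by (simp only: sum_gen_part_commutator sum.neutral_const)
  finally show "(realization psi_fps \<mu> * realization psi_tilde_fps \<nu>) \<rhd> p =
      (realization psi_tilde_fps \<nu> * realization psi_fps \<mu>) \<rhd> p" by simp
qed

section \<open>Surjectivity of \<Omega>\<close>

text \<open>Induction on the degree: as F(0) = 1, \<open>realization F i\<close> sends a monomial to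
  x_i times it plus terms of lower degree, and the image of the subalgebra is stable under the
  generators.\<close>

lemma Omega_surj:
  assumes F: "fps_nth F 0 = 1"
  shows "\<exists>a\<in>unital_subalgebra (range (realization F)). Omega a = p"
proof -
  let ?A = "unital_subalgebra (range (realization F))"
  define V where "V = Omega ` ?A"
  have V: "p \<in> V \<longleftrightarrow> (\<exists>a\<in>?A. a \<rhd> 1 = p)" for p
    by (auto simp: V_def Omega_def)
  have add: "p + q \<in> V" if "p \<in> V" "q \<in> V" for p q
    using that unfolding V by (metis unital_subalgebra.add act_add)
  have scale: "pconst c * p \<in> V" if "p \<in> V" for p c
    using that unfolding V by (metis unital_subalgebra.scale act_weyl_scale)
  have act: "realization F i \<rhd> p \<in> V" if "p \<in> V" for p i
    using that unfolding V by (metis unital_subalgebra.mult unital_subalgebra.gen act_mult rangeI)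
  have one: "1 \<in> V"
    unfolding V by (metis unital_subalgebra.one act_one)
  have zero: "0 \<in> V" using scale[OF one, of 0] by simp
  have sum: "sum f S \<in> V" if "\<And>x. x \<in> S \<Longrightarrow> f x \<in> V" for f and S :: "'n mindex set"
    using that by (induction S rule: infinite_finite_induct) (auto simp: zero add)
  have "p \<in> V" if "deg_less p N" for p N
    using that
  proof (induction N arbitrary: p)
    case 0
    then show ?case by (simp add: zero)
  next
    case (Suc N)
    have single: "Poly_Mapping.single m c \<in> V" if "mdeg m = N" for m c
    proof (cases "m = 0")
      case True
      then show ?thesis using scale[OF one, of c] by simp
    next
      case False
      then obtain i where "lookup m i > 0"
        by (metis gr0I lookup_zero poly_mapping_eqI)
      then obtain m' where m: "m = m' + unit_index i" by (rule decomp_unit)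
      let ?q = "Poly_Mapping.single m' c"
      have q: "deg_less ?q N"
        using that by (simp add: m mdeg_add deg_less_def)
      \<comment> \<open>The variable x_i divides the monomial m, so N > 0 and the leading term k = 0
        can be split off.\<close>
      have N: "{..<N} = insert 0 {1..<N}"
        using that by (auto simp: m mdeg_add)
      define r where "r = (\<Sum>k\<in>{1..<N}. pconst (fps_nth F k) * (gen_part k i \<rhd> ?q))"
      \<comment> \<open>For k \<ge> 1 the bound N + 1 - k is at most N, which brings the remainder
        under the induction hypothesis.\<close>
      have "deg_less r N"
        unfolding r_def
        by (intro deg_less_sum deg_less_pconst_mult deg_less_mono[OF deg_less_gen_part[OF q]]) auto
      then have "pconst (- 1) * r \<in> V" by (intro scale Suc.IH)
      moreover have "realization F i \<rhd> ?q = Poly_Mapping.single m c + r"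
        unfolding act_realization[OF q order.refl] N
        by (simp add: F r_def gen_part_0 var_def mult_single m add.commute[of m'] )
      moreover have "realization F i \<rhd> ?q \<in> V" by (intro act Suc.IH q)
      ultimately show ?thesis
        using add[of "realization F i \<rhd> ?q" "pconst (- 1) * r"] by (simp add: single_uminus)
    qed
    have "Poly_Mapping.single m (lookup p m) \<in> V" if "m \<in> Poly_Mapping.keys p" for m
    proof (cases "mdeg m < N")
      case True
      then show ?thesis by (intro Suc.IH) (simp add: deg_less_def)
    next
      case False
      then show ?thesis using that Suc.prems by (force intro!: single simp: deg_less_def)
    qed
    then show ?case by (subst poly_ring_sum_single) (rule sum)
  qed
  then have "p \<in> V" using deg_less_exists by blast
  then show ?thesis by (auto simp: V_def)
qed

end

section \<open>Star-products of commuting generators\<close>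

text \<open>Being in the image, f gets from \<open>inv_into\<close> a genuine preimage rather than
  an arbitrary value.\<close>

lemma Omega_inv:
  assumes "\<exists>a\<in>unital_subalgebra (range u). Omega a = f"
  shows "Omega_inv u f \<in> unital_subalgebra (range u)" "Omega_inv u f \<rhd> 1 = f"
proof -
  have "f \<in> Omega ` unital_subalgebra (range u)" using assms by blast
  then show "Omega_inv u f \<in> unital_subalgebra (range u)" "Omega_inv u f \<rhd> 1 = f"
    unfolding Omega_inv_def
    using inv_into_into[of f Omega] f_inv_into_f[of f Omega] by (auto simp: Omega_def)
qed

text \<open>Two structural inductions: first over b against a fixed generator in S, then over a
  against b.\<close>

lemma unital_subalgebra_commute:
  assumes "a \<in> unital_subalgebra S" "b \<in> unital_subalgebra T"
    and ST: "\<And>s t. s \<in> S \<Longrightarrow> t \<in> T \<Longrightarrow> s * t = t * s"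
  shows "a * b = b * a"
proof -
  have scale: "weyl_scale c x * y = weyl_scale c (x * y)" "x * weyl_scale c y = weyl_scale c (x * y)"
    for c :: 'b and x y :: "('a, 'b) weyl"
    by (rule act_faithful, simp add: act_mult act_weyl_scale act_pconst_mult)+
  have gen: "s * b = b * s" if "s \<in> S" for s
    using assms(2)
  proof induction
    case (mult x y)
    then show ?case by (metis mult.assoc)
  qed (use that ST in \<open>auto simp: algebra_simps scale\<close>)
  from assms(1) show ?thesis
  proof induction
    case (mult x y)
    then show ?case by (metis mult.assoc)
  qed (auto simp: algebra_simps scale gen)
qed

text \<open>\<open>Omega_inv u g\<close> and \<open>Omega_inv v g\<close> send 1 to the same g, so
  one may replace the other as right factor; after commuting, the same exchange is made for
  f.\<close>

lemma star_product_commuting_generators: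
  assumes comm: "\<And>i j. u i * v j = v j * u i"
    and u: "\<And>p. \<exists>a\<in>unital_subalgebra (range u). Omega a = p"
    and v: "\<And>p. \<exists>a\<in>unital_subalgebra (range v). Omega a = p"
  shows "star_product u f g = star_product v g f"
proof -
  have "star_product u f g = Omega_inv u f \<rhd> (Omega_inv v g \<rhd> 1)"
    by (simp add: star_product_def Omega_def act_mult Omega_inv[OF u] Omega_inv[OF v])
  also have "\<dots> = Omega_inv v g \<rhd> (Omega_inv u f \<rhd> 1)"
    unfolding act_mult[symmetric]
    using unital_subalgebra_commute[OF Omega_inv(1)[OF u, of f] Omega_inv(1)[OF v, of g]] comm
    by fastforce
  also have "\<dots> = star_product v g f"
    by (simp add: star_product_def Omega_def act_mult Omega_inv[OF u] Omega_inv[OF v])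
  finally show ?thesis .
qed

section \<open>From a Lie algebra with basis to its structure constants\<close>

lemma structure_constants_of_basis:
  fixes C :: "'n::finite \<Rightarrow> 'n \<Rightarrow> 'n \<Rightarrow> 'k::field_char_0"
    and sc :: "'k \<Rightarrow> 'g::ab_group_add \<Rightarrow> 'g"
  assumes "lie_algebra sc bracket" "is_basis sc X"
    and bracket_basis: "\<And>\<mu> \<nu>. bracket (X \<mu>) (X \<nu>) = (\<Sum>\<alpha>\<in>UNIV. sc (C \<mu> \<nu> \<alpha>) (X \<alpha>))"
  shows "structure_constants C"
proof -
  interpret lie_algebra sc bracket by fact
  interpret L: Vector_Spaces.linear sc sc "\<lambda>u. bracket u v" for v by (rule linear_left)
  interpret R: Vector_Spaces.linear sc sc "bracket u" for u by (rule linear_right)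
  have inj: "inj X" and indep: "independent (range X)"
    using assms(2) by (auto simp: is_basis_def)
  \<comment> \<open>Independence concerns the set \<open>range X\<close>; injectivity transports the
    coefficients to it along \<open>inv X\<close>.\<close>
  have coeff0: "c i = 0" if "(\<Sum>\<alpha>\<in>UNIV. sc (c \<alpha>) (X \<alpha>)) = 0" for c i
  proof -
    have "(\<Sum>v\<in>range X. sc (c (inv X v)) v) = 0"
      using that inj by (simp add: sum.reindex)
    then have "c (inv X (X i)) = 0"
      using independentD[OF indep finite_imageI[OF finite] order.refl, of "\<lambda>v. c (inv X v)" "X i"] by simp
    then show ?thesis using inj by simp
  qed
  have bracket_antisym: "bracket v u = - bracket u v" for u v
  proof -
    have "0 = bracket (u + v) (u + v)" by (rule alternating[symmetric])
    also have "\<dots> = bracket v u + bracket u v"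
      unfolding L.add R.add by (simp add: alternating)
    finally show ?thesis by (simp add: eq_neg_iff_add_eq_0)
  qed
  have bracket2: "bracket (bracket (X i) (X j)) (X k) =
      (\<Sum>l\<in>UNIV. sc (\<Sum>e\<in>UNIV. C i j e * C e k l) (X l))" for i j k
  proof -
    have "bracket (bracket (X i) (X j)) (X k) = (\<Sum>e\<in>UNIV. \<Sum>l\<in>UNIV. sc (C i j e * C e k l) (X l))"
      by (simp add: bracket_basis L.sum L.scale scale_sum_right)
    then show ?thesis
      by (subst (asm) sum.swap) (simp add: scale_sum_left)
  qed
  show ?thesis
  proof
    fix i j k l
    have "C j i k + C i j k = 0" for i j k
    proof (rule coeff0)
      show "(\<Sum>\<alpha>\<in>UNIV. sc (C j i \<alpha> + C i j \<alpha>) (X \<alpha>)) = 0"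
        using bracket_antisym[of "X i" "X j"] by (simp add: bracket_basis scale_left_distrib sum.distrib)
    qed
    then show anti: "C j i k = - C i j k" for i j k
      by (simp add: eq_neg_iff_add_eq_0)
    have "(\<Sum>e\<in>UNIV. C i j e * C e k l) + (\<Sum>e\<in>UNIV. C j k e * C e i l) + (\<Sum>e\<in>UNIV. C k i e * C e j l) = 0"
    proof (rule coeff0)
      \<comment> \<open>The Lie algebra axiom nests brackets on the right, \<open>bracket2\<close>
        on the left; three uses of antisymmetry change only the overall sign.\<close>
      have neg: "- z + - x + - y = - (x + y + z)" for x y z :: 'g
        by simp
      have "bracket (bracket (X i) (X j)) (X k) + bracket (bracket (X j) (X k)) (X i)
          + bracket (bracket (X k) (X i)) (X j) = 0"
        using jacobi[of "X i" "X j" "X k"] bracket_antisym[of "bracket (X i) (X j)" "X k"]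
          bracket_antisym[of "bracket (X j) (X k)" "X i"] bracket_antisym[of "bracket (X k) (X i)" "X j"]
        by (simp only: neg) simp
      then show "(\<Sum>l\<in>UNIV. sc ((\<Sum>e\<in>UNIV. C i j e * C e k l) + (\<Sum>e\<in>UNIV. C j k e * C e i l)
          + (\<Sum>e\<in>UNIV. C k i e * C e j l)) (X l)) = 0"
        by (simp add: bracket2 scale_left_distrib sum.distrib)
    qed
    moreover have "(\<Sum>e\<in>UNIV. C j k e * C e i l) = - (\<Sum>e\<in>UNIV. C j k e * C i e l)"
      by (simp add: anti[of i] sum_negf)
    moreover have "(\<Sum>e\<in>UNIV. C k i e * C e j l) = - (\<Sum>e\<in>UNIV. C i k e * C e j l)"
      by (simp add: anti[of k i] sum_negf)
    ultimately show "(\<Sum>e\<in>UNIV. C i j e * C e k l) =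
        (\<Sum>e\<in>UNIV. C i k e * C e j l) + (\<Sum>e\<in>UNIV. C j k e * C i e l)"
      by (simp add: algebra_simps)
  qed
qed

theorem theorem5:
  fixes C :: "real \<Rightarrow> 'n::finite \<Rightarrow> 'n \<Rightarrow> 'n \<Rightarrow> 'k::real_normed_field"
    and scaleX :: "'k \<Rightarrow> 'g::ab_group_add \<Rightarrow> 'g"
    and bracketX :: "real \<Rightarrow> 'g \<Rightarrow> 'g \<Rightarrow> 'g"
    and X :: "real \<Rightarrow> 'n \<Rightarrow> 'g"
    and scaleY :: "'k \<Rightarrow> 'l::ab_group_add \<Rightarrow> 'l"
    and bracketY :: "real \<Rightarrow> 'l \<Rightarrow> 'l \<Rightarrow> 'l"
    and Y :: "real \<Rightarrow> 'n \<Rightarrow> 'l"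
    and psi :: "real \<Rightarrow> 'g \<Rightarrow> ('n, 'k) weyl"
    and psi_tilde :: "real \<Rightarrow> 'l \<Rightarrow> ('n, 'k) weyl"
    and h :: real
    and f g :: "('n, 'k) poly_ring"
  assumes lie_X: "\<And>h. lie_algebra scaleX (bracketX h)"
    and basis_X: "\<And>h. is_basis scaleX (X h)"
    and bracket_X: "\<And>h \<mu> \<nu>. bracketX h (X h \<mu>) (X h \<nu>) = (\<Sum>\<alpha>\<in>UNIV. scaleX (C h \<mu> \<nu> \<alpha>) (X h \<alpha>))"
    and lie_Y: "\<And>h. lie_algebra scaleY (bracketY h)"
    and basis_Y: "\<And>h. is_basis scaleY (Y h)"
    and bracket_Y: "\<And>h \<mu> \<nu>. bracketY h (Y h \<mu>) (Y h \<nu>) = - (\<Sum>\<alpha>\<in>UNIV. scaleY (C h \<mu> \<nu> \<alpha>) (Y h \<alpha>))"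
    and limit_C: "\<And>\<mu> \<nu> \<alpha>. ((\<lambda>h. C h \<mu> \<nu> \<alpha>) \<longlongrightarrow> 0) (at 0)"
    and linear_psi: "\<And>h. Vector_Spaces.linear scaleX weyl_scale (psi h)"
    and psi_X: "\<And>h \<mu>. psi h (X h \<mu>) =
           (\<Sum>\<alpha>\<in>UNIV. weyl_x \<alpha> * fps_matrix psi_fps (struct_matrix (C h)) $ \<mu> $ \<alpha>)"
    and linear_psi_tilde: "\<And>h. Vector_Spaces.linear scaleY weyl_scale (psi_tilde h)"
    and psi_tilde_Y: "\<And>h \<mu>. psi_tilde h (Y h \<mu>) =
           (\<Sum>\<alpha>\<in>UNIV. weyl_x \<alpha> * fps_matrix psi_tilde_fps (struct_matrix (C h)) $ \<mu> $ \<alpha>)"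
  shows "star_product (\<lambda>\<mu>. psi h (X h \<mu>)) f g = star_product (\<lambda>\<mu>. psi_tilde h (Y h \<mu>)) g f"
proof -
  interpret structure_constants "C h"
    using lie_X basis_X bracket_X by (rule structure_constants_of_basis)
  \<comment> \<open>At the given h, both families of generators are realizations over the one matrix
    built from \<open>C h\<close>.\<close>
  have X: "(\<lambda>\<mu>. psi h (X h \<mu>)) = realization psi_fps"
    by (simp add: psi_X realization_def fun_eq_iff)
  have Y: "(\<lambda>\<mu>. psi_tilde h (Y h \<mu>)) = realization psi_tilde_fps"
    by (simp add: psi_tilde_Y realization_def fun_eq_iff)
  show ?thesis
    unfolding X Y
    by (intro star_product_commuting_generators realizations_commute Omega_surj
        psi_fps_nth_0 psi_tilde_fps_nth_0)
qed

end
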